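(* Let $\mathcal C$ be an algebraic plane curve over $\mathbb C$ of degree $n$ defined by an irreducible polynomial $f\in\mathbb R[x,y]$, such that $(0:1:0)$ is not an infinity point of $\mathcal C$. Then $\mathcal C$ is perfect if and only if it has a unique infinity branch $B$ and $\deg(B)=n$.
   Context: Curves. A plane curve over $\mathbb C$ is the zero set in $\mathbb C^2$ of an irreducible polynomial $f\in\mathbb C[x,y]$ of degree $d\ge 1$; $d$ is the degree of the curve. Write $f=f_d+f_{d-1}+\cdots+f_0$ with $f_i$ homogeneous of degree $i$, and $F(x,y,z)=f_d+zf_{d-1}+\cdots+z^df_0$ for the polynomial of its projective closure. The infinity points are the points $(a:b:0)$ with $f_d(a,b)=0$. Infinity branches. Let $\mathcal C$ be a curve and $(1:m:0)$, $m\in\mathbb C$, an infinity point. Put $g(y,z)=F(1,y,z)$. Let $\varphi(z)=m+a_1z^{N_1/N}+a_2z^{N_2/N}+\cdots$ (finitely or infinitely many terms, $a_i\ne0$, $N,N_i\in\mathbb N$, $0<N_1<N_2<\cdots$) be a Puiseux series with $g(\varphi(z),z)=0$ and ramification index $N$ (the least common denominator of its exponents). Its conjugates are $\varphi_j(z)=m+a_1c_j^{N_1}z^{N_1/N}+a_2c_j^{N_2}z^{N_2/N}+\cdots$, where $c_1,\dots,c_N$ are the $N$-th roots of unity. Put $r_j(z)=z\varphi_j(z^{-1})=mz+a_1c_j^{N_1}z^{1-N_1/N}+\cdots$, which converges for $|z|>M$ for some $M>0$. The set $B=\bigcup_{j=1}^N L_j$, with leaves $L_j=\{(z,r_j(z))\in\mathbb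 C^2: |z|>M\}$, is an infinity branch of $\mathcal C$ associated to $(1:m:0)$ (one branch for each conjugacy class of Puiseux solutions). Degree of a branch. Let $k\ge0$ be such that $N_1,\dots,N_k$ are exactly the $N_i$ with $N_i\le N$ (i.e. the terms of $r$ with non-negative exponent are $mz$ and those of index $1,\dots,k$), and let $b=\gcd(N,N_1,\dots,N_k)$. Then $\deg(B):=N/b$. Approaching curves. Let $d(p,\overline{\mathcal C})$ be the usual distance in $\mathbb C^2$ from a point $p$ to a curve $\overline{\mathcal C}$. A curve $\overline{\mathcal C}$ approaches $\mathcal C$ at its infinity branch $B$ if there is a leaf $\{(z,r(z)):|z|>M\}\subset B$ with $\lim_{z\to\infty}d((z,r(z)),\overline{\mathcal C})=0$. Perfect curves. A curve of degree $d$ (not having $(0:1:0)$ as infinity point) is perfect if it cannot be approached, at any of its infinity branches, by any curve over $\mathbb C$ of degree less than $d$. *)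

theory Defs
  imports "HOL-Analysis.Analysis" "HOL-Computational_Algebra.Computational_Algebra"
begin

text \<open>
  A polynomial in the variables \<open>x, y\<close> is an element of \<open>'a poly poly\<close>: the outer variable is \<open>y\<close>
  and the inner one is \<open>x\<close>, so that the coefficient of \<open>x^i y^j\<close> in \<open>f\<close> is
  \<open>coeff (coeff f j) i\<close>.

  A curve is represented by a defining polynomial. An irreducible polynomial is determined up to a
  nonzero constant factor by its zero set in the complex plane, and none of the notions below
  depends on that factor.
\<close>

definition total_degree :: "'a::zero poly poly \<Rightarrow> nat" where
  "total_degree f = Max {i + j | i j. coeff (coeff f j) i \<noteq> 0}"

definition complexify :: "real poly poly \<Rightarrow> complex poly poly" where
  "complexify f = map_poly (map_poly complex_of_real) f"

text \<open>The units of \<open>complex poly poly\<close> are the nonzero constants, so an irreducible element has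
  total degree at least 1.\<close>

definition curve_poly :: "complex poly poly \<Rightarrow> bool" where
  "curve_poly f \<longleftrightarrow> irreducible f"

definition curve_points :: "complex poly poly \<Rightarrow> (complex \<times> complex) set" where
  "curve_points f = {(x, y). poly (poly f [:y:]) x = 0}"

text \<open>
  The homogeneous part of degree \<open>k\<close> and the homogenization, evaluated in a commutative ring to
  which the coefficients are mapped by \<open>h\<close>; this ring is \<open>complex\<close> (with \<open>h = id\<close>) for points and
  \<open>complex fps\<close> (with \<open>h = fps_const\<close>) for the substitution of power series.
\<close>

definition homog_part ::
    "(complex \<Rightarrow> 'b::comm_ring_1) \<Rightarrow> complex poly poly \<Rightarrow> nat \<Rightarrow> 'b \<Rightarrow> 'b \<Rightarrow> 'b" where
  "homog_part h f k x y = (\<Sum>j\<le>k. h (coeff (coeff f j) (k - j)) * x ^ (k - j) * y ^ j)"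

definition homogenization ::
    "(complex \<Rightarrow> 'b::comm_ring_1) \<Rightarrow> complex poly poly \<Rightarrow> 'b \<Rightarrow> 'b \<Rightarrow> 'b \<Rightarrow> 'b" where
  "homogenization h f x y z =
     (\<Sum>k\<le>total_degree f. z ^ (total_degree f - k) * homog_part h f k x y)"

text \<open>The point \<open>(a : b : 0)\<close> of the projective plane is an infinity point.\<close>

definition infinity_point :: "complex poly poly \<Rightarrow> complex \<Rightarrow> complex \<Rightarrow> bool" where
  "infinity_point f a b \<longleftrightarrow> (a, b) \<noteq> (0, 0) \<and> homog_part id f (total_degree f) a b = 0"

text \<open>
  A pair \<open>(N, p)\<close> with \<open>N > 0\<close> stands for the Puiseux series \<open>\<phi>(z) = p(z^(1/N))\<close>, whose exponents
  are the \<open>i / N\<close> with \<open>p $ i \<noteq> 0\<close>. Its ramification index is \<open>N\<close> if \<open>N\<close> is the least common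
  denominator of these exponents, which makes the representation unique.
\<close>

type_synonym puiseux = "nat \<times> complex fps"

definition ramification_index :: "puiseux \<Rightarrow> nat" where
  "ramification_index = (\<lambda>(N, p).
     LEAST K. K > 0 \<and> (\<forall>i. p $ i \<noteq> 0 \<longrightarrow> of_nat K * (of_nat i / of_nat N) \<in> (\<int> :: rat set)))"

text \<open>With \<open>z = t^N\<close> the equation \<open>F(1, \<phi>(z), z) = 0\<close> becomes \<open>F(1, p(t), t^N) = 0\<close>.\<close>

definition puiseux_solution :: "complex poly poly \<Rightarrow> complex \<Rightarrow> puiseux \<Rightarrow> bool" where
  "puiseux_solution f m = (\<lambda>(N, p).
     N > 0 \<and> ramification_index (N, p) = N \<and> p $ 0 = m \<and>
     homogenization fps_const f 1 p (fps_X ^ N) = 0)"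

definition conjugates :: "puiseux \<Rightarrow> puiseux set" where
  "conjugates = (\<lambda>(N, p). {(N, Abs_fps (\<lambda>i. p $ i * c ^ i)) | c. c ^ N = 1})"

text \<open>
  There is one infinity branch for each conjugacy class of Puiseux solutions. As a point set a branch
  depends on the choice of the radius \<open>M\<close>; it is therefore represented by the conjugacy class, whose
  members correspond to the leaves \<open>{(z, leaf_fun \<phi> z) | z. cmod z > M}\<close>.
\<close>

definition infinity_branches :: "complex poly poly \<Rightarrow> puiseux set set" where
  "infinity_branches f =
     {conjugates \<phi> | \<phi> m. infinity_point f 1 m \<and> puiseux_solution f m \<phi>}"

text \<open>
  The leaf function \<open>r(z) = z \<phi>(1/z)\<close>, where the fractional powers of \<open>1/z\<close> are the powers of its
  principal \<open>N\<close>-th root. Any other determination of the root permutes, for each \<open>z\<close>, the values of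
  the \<open>N\<close> conjugate leaves.
\<close>

definition leaf_param :: "puiseux \<Rightarrow> complex \<Rightarrow> complex" where
  "leaf_param = (\<lambda>(N, p) z. (1 / z) powr (1 / of_nat N))"

definition leaf_fun :: "puiseux \<Rightarrow> complex \<Rightarrow> complex" where
  "leaf_fun \<phi> z = z * eval_fps (snd \<phi>) (leaf_param \<phi> z)"

definition leaf_converges :: "puiseux \<Rightarrow> real \<Rightarrow> bool" where
  "leaf_converges \<phi> M \<longleftrightarrow>
     (\<forall>z. cmod z > M \<longrightarrow> summable (\<lambda>i. snd \<phi> $ i * leaf_param \<phi> z ^ i))"

text \<open>The exponents of \<open>r\<close> are the \<open>1 - i/N\<close> with \<open>p $ i \<noteq> 0\<close>; they are non-negative for \<open>i \<le> N\<close>.\<close>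

definition puiseux_degree :: "puiseux \<Rightarrow> nat" where
  "puiseux_degree = (\<lambda>(N, p). N div Gcd (insert N {i. 0 < i \<and> i \<le> N \<and> p $ i \<noteq> 0}))"

text \<open>Conjugate series have the same \<open>N\<close> and the same support, hence the same degree.\<close>

definition branch_degree :: "puiseux set \<Rightarrow> nat" where
  "branch_degree B = the_elem (puiseux_degree ` B)"

text \<open>The curve of \<open>g\<close> approaches the branch \<open>B\<close> (of some other curve). The metric on
  \<open>complex \<times> complex\<close> is the Euclidean one.\<close>

definition approaches :: "complex poly poly \<Rightarrow> puiseux set \<Rightarrow> bool" where
  "approaches g B \<longleftrightarrow>
     (\<exists>\<phi>\<in>B. \<exists>M>0. leaf_converges \<phi> M \<and>
        ((\<lambda>z. infdist (z, leaf_fun \<phi> z) (curve_points g)) \<longlongrightarrow> 0) at_infinity)"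

definition perfect :: "complex poly poly \<Rightarrow> bool" where
  "perfect f \<longleftrightarrow> \<not> infinity_point f 0 1 \<and>
     (\<forall>B\<in>infinity_branches f. \<forall>g.
        curve_poly g \<and> total_degree g < total_degree f \<longrightarrow> \<not> approaches g B)"

end

theory Submission
  imports Defs "HOL-Computational_Algebra.Field_as_Ring"
begin

text \<open>
  Let \<open>B\<close> be a branch of degree \<open>e\<close>, given by a Puiseux series with ramification index \<open>N\<close>. The terms of
  its leaf with non-negative exponent parametrize a curve \<open>s \<mapsto> (s ^ e, q s)\<close> with \<open>degree q \<le> e\<close>; its
  implicit equation, the product of \<open>y - q (z * s)\<close> over the \<open>e\<close>-th roots of unity \<open>z\<close>, is irreducible of
  total degree at most \<open>e\<close>, and it approaches \<open>B\<close>. Conversely, no polynomial of smaller degree in \<open>y\<close> has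
  zeros that tend to this parametrized curve, by Lagrange interpolation at the \<open>e\<close> conjugates of \<open>q\<close>.

  Hence a curve of degree \<open>n\<close> with a unique branch, of degree \<open>n\<close>, is perfect. If conversely the curve is
  perfect, take any convergent Puiseux solution; one exists by Hensel's lemma with geometric coefficient
  bounds. Then \<open>n \<le> e \<le> N\<close>, while its \<open>N\<close> conjugates are distinct roots of a polynomial of degree \<open>n\<close>, so
  \<open>e = N = n\<close>. The conjugates thus exhaust the roots, and every other branch coincides with \<open>B\<close>.
\<close>

section \<open>Convergent power series\<close>

text \<open>Infinity branches are formal, whereas approaching a branch presupposes a convergent
  leaf: a branch without convergent leaves would be approached by no curve, and perfectness would
  say nothing about it. One direction therefore needs a convergent solution, but only one, since the
  remaining branches are handled by counting formal roots; in the other direction, approach itself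
  supplies the convergence. The obstacle in the lower bound is that the other curve may have
  \<open>(0:1:0)\<close> as infinity point and its nearest point may lie over a different abscissa,
  so branches cannot be compared term by term. Interpolation avoids the branches of that curve
  altogether.\<close>

definition convergent_fps :: "complex fps \<Rightarrow> bool" where
  "convergent_fps p \<longleftrightarrow> fps_conv_radius p > 0"

lemma convergent_fps_bound:
  assumes "convergent_fps p"
  obtains C R where "C \<ge> 0" "R > 0" "\<And>i. cmod (p $ i) \<le> C * R ^ i"
proof -
  obtain r where r: "0 < ereal r" "ereal r < fps_conv_radius p"
    using assms ereal_dense2[of 0 "fps_conv_radius p"]
    unfolding convergent_fps_def by (metis zero_ereal_def)
  have r0: "r > 0" using r(1) by simp
  have "summable (\<lambda>n. p $ n * of_real r ^ n)"
    using r r0 by (intro summable_fps) auto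
  then have "Bseq (\<lambda>n. p $ n * of_real r ^ n)"
    by (intro convergent_imp_Bseq summable_LIMSEQ_zero[THEN convergentI])
  then obtain C where C: "C > 0" "\<And>n. cmod (p $ n * of_real r ^ n) \<le> C"
    by (auto simp: Bseq_def)
  show ?thesis
  proof (rule that[of C "1 / r"])
    fix i
    have "cmod (p $ i) * r ^ i \<le> C" using C(2)[of i] r0 by (simp add: norm_mult norm_power)
    then show "cmod (p $ i) \<le> C * (1 / r) ^ i"
      using r0 by (simp add: field_simps)
  qed (use C r0 in auto)
qed

lemma convergent_fpsI:
  assumes "\<And>i. cmod (p $ i) \<le> C * R ^ i"
  shows "convergent_fps p"
proof -
  define r where "r = 1 / (2 * (\<bar>R\<bar> + 1))"
  have r0: "r > 0" by (simp add: r_def)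
  have "\<bar>R\<bar> * r < 1" unfolding r_def by (simp add: field_simps)
  then have "summable (\<lambda>n. \<bar>C\<bar> * (\<bar>R\<bar> * r) ^ n)"
    using r0 by (intro summable_mult summable_geometric) simp
  then have "summable (\<lambda>n. p $ n * of_real r ^ n)"
  proof (rule summable_comparison_test')
    fix n :: nat
    have "cmod (p $ n) \<le> \<bar>C\<bar> * \<bar>R\<bar> ^ n"
      using assms[of n] by (metis abs_ge_self abs_mult order_trans power_abs)
    then show "cmod (p $ n * of_real r ^ n) \<le> \<bar>C\<bar> * (\<bar>R\<bar> * r) ^ n"
      using r0 mult_right_mono[of "cmod (p $ n)" "\<bar>C\<bar> * \<bar>R\<bar> ^ n" "r ^ n"]
      by (simp add: norm_mult norm_power power_mult_distrib mult.assoc)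
  qed
  then have "conv_radius (\<lambda>n. p $ n) \<ge> norm (of_real r :: complex)"
    by (rule conv_radius_geI)
  then have "0 < ereal r" "ereal r \<le> fps_conv_radius p"
    using r0 by (auto simp: fps_conv_radius_def)
  then show ?thesis unfolding convergent_fps_def by (rule less_le_trans)
qed

lemma convergent_fps_const [simp]: "convergent_fps (fps_const c)"
  and convergent_fps_0 [simp]: "convergent_fps 0"
  and convergent_fps_1 [simp]: "convergent_fps 1"
  and convergent_fps_of_nat [simp]: "convergent_fps (of_nat n)"
  and convergent_fps_X_power [simp]: "convergent_fps (fps_X ^ n)"
  and convergent_fps_uminus [simp]: "convergent_fps (- p) \<longleftrightarrow> convergent_fps p"
  and convergent_fps_shift [simp]: "convergent_fps (fps_shift n p) \<longleftrightarrow> convergent_fps p"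
  by (simp_all add: convergent_fps_def flip: fps_const_1_eq_1 fps_of_nat)

lemma convergent_fps_add:
  "convergent_fps p \<Longrightarrow> convergent_fps q \<Longrightarrow> convergent_fps (p + q)"
  using fps_conv_radius_add[of p q] unfolding convergent_fps_def
  by (meson less_le_trans min_less_iff_conj)

lemma convergent_fps_mult:
  "convergent_fps p \<Longrightarrow> convergent_fps q \<Longrightarrow> convergent_fps (p * q)"
  using fps_conv_radius_mult[of p q] unfolding convergent_fps_def
  by (meson less_le_trans min_less_iff_conj)

lemma convergent_fps_power: "convergent_fps p \<Longrightarrow> convergent_fps (p ^ n)"
  using fps_conv_radius_power[of p n] unfolding convergent_fps_def by (rule less_le_trans[rotated])

lemma convergent_fps_sum:
  "(\<And>i. i \<in> A \<Longrightarrow> convergent_fps (p i)) \<Longrightarrow> convergent_fps (sum p A)"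
  by (induction A rule: infinite_finite_induct) (auto intro: convergent_fps_add)

lemma convergent_fps_compose_X_power:
  assumes "convergent_fps p" "N > 0"
  shows "convergent_fps (p oo fps_X ^ N)"
proof -
  obtain C R where C: "C \<ge> 0" "R > 0" "\<And>i. cmod (p $ i) \<le> C * R ^ i"
    using convergent_fps_bound[OF assms(1)] by blast
  show ?thesis
  proof (rule convergent_fpsI)
    fix i
    \<comment> \<open>Spreading out the exponents replaces \<open>R ^ i\<close> by
      \<open>R ^ (i div N)\<close>; for \<open>R < 1\<close> this is the larger power, hence
      \<open>max 1 R\<close>.\<close>
    have "C * R ^ (i div N) \<le> C * max 1 R ^ i"
    proof (rule mult_left_mono)
      have "R ^ (i div N) \<le> max 1 R ^ (i div N)"
        using C(2) by (intro power_mono) auto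
      also have "\<dots> \<le> max 1 R ^ i" by (rule power_increasing) auto
      finally show "R ^ (i div N) \<le> max 1 R ^ i" .
    qed (use C in auto)
    then show "cmod ((p oo fps_X ^ N) $ i) \<le> C * max 1 R ^ i"
      using assms(2) C(1) C(3)[of "i div N"] by (auto simp: fps_nth_compose_X_power)
  qed
qed

lemma convergent_fps_bound_common:
  assumes "finite A" "\<And>a. a \<in> A \<Longrightarrow> convergent_fps (p a)"
  obtains C R where "C \<ge> 0" "R > 0" "\<And>a i. a \<in> A \<Longrightarrow> cmod (p a $ i) \<le> C * R ^ i"
proof -
  have "\<forall>a\<in>A. \<exists>C R. C \<ge> 0 \<and> R > 0 \<and> (\<forall>i. cmod (p a $ i) \<le> C * R ^ i)"
    using assms(2) convergent_fps_bound by metis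
  then obtain C R where CR: "\<And>a. a \<in> A \<Longrightarrow> C a \<ge> 0" "\<And>a. a \<in> A \<Longrightarrow> R a > 0"
    "\<And>a i. a \<in> A \<Longrightarrow> cmod (p a $ i) \<le> C a * R a ^ i" by metis
  \<comment> \<open>The summand 1 keeps the common ratio positive when \<open>A\<close> is
    empty.\<close>
  show ?thesis
  proof (rule that[of "sum C A" "1 + sum R A"])
    show "sum C A \<ge> 0" using CR by (intro sum_nonneg) auto
    have R0: "sum R A \<ge> 0" using CR by (intro sum_nonneg) (auto intro: less_imp_le)
    then show "1 + sum R A > 0" by simp
    fix a i assume a: "a \<in> A"
    have "C a \<le> sum C A" "R a \<le> sum R A"
      using assms(1) a CR(1) less_imp_le[OF CR(2)] by (auto intro!: member_le_sum)
    then have "C a * R a ^ i \<le> sum C A * (1 + sum R A) ^ i"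
      using CR(1,2)[OF a] by (intro mult_mono power_mono) auto
    then show "cmod (p a $ i) \<le> sum C A * (1 + sum R A) ^ i"
      using CR(3)[OF a, of i] by linarith
  qed
qed

section \<open>Majorants for quadratic recursions\<close>

lemma sum_inverse_squares_le: "(\<Sum>i\<in>{0<..<m}. 1 / real i ^ 2) \<le> 2"
proof -
  \<comment> \<open>The bound is sharpened to \<open>2 - 1 / m\<close> so that the induction closes
    by telescoping.\<close>
  have "(\<Sum>i\<in>{0<..<Suc m}. 1 / real i ^ 2) \<le> 2 - 1 / m" if "m \<ge> 1" for m :: nat
    using that
  proof (induction m rule: dec_induct)
    case base
    have "{0<..<Suc 1} = {1::nat}" by auto
    then show ?case by simp
  next
    case (step m)
    have "{0<..<Suc (Suc m)} = insert (Suc m) {0<..<Suc m}" by auto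
    moreover have "1 / real (Suc m) ^ 2 \<le> 1 / m - 1 / Suc m"
    proof -
      have "1 / real (Suc m) ^ 2 \<le> 1 / (real m * real (Suc m))"
        using step(1) by (intro divide_left_mono) (auto simp: power2_eq_square)
      also have "\<dots> = 1 / m - 1 / Suc m"
        using step(1) by (simp add: field_simps)
      finally show ?thesis .
    qed
    ultimately show ?case using step by simp
  qed
  note * = this
  show ?thesis
  proof (cases "m \<le> 1")
    case False
    then have "(\<Sum>i\<in>{0<..<m}. 1 / real i ^ 2) \<le> 2 - 1 / real (m - 1)"
      using *[of "m - 1"] by simp
    also have "\<dots> \<le> 2" by simp
    finally show ?thesis .
  next
    case True
    then have "{0<..<m} = {}" by auto
    then show ?thesis by simp
  qed
qed

text \<open>For \<open>a + b = k\<close>, the inequality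
  \<open>(a + b) ^ 2 \<le> 2 * (a ^ 2 + b ^ 2)\<close> bounds the product of the inverse squares by
  \<open>2 / k ^ 2\<close> times their sum. Each of the two resulting sums is at most 2, whence
  8.\<close>

lemma inverse_square_convolution_le:
  "(\<Sum>i\<in>{0<..<k}. 1 / (real i ^ 2 * real (k - i) ^ 2)) \<le> 8 / real k ^ 2"
proof (cases "k = 0")
  case False
  have "1 / (real i ^ 2 * real (k - i) ^ 2) \<le> 2 / real k ^ 2 * (1 / real i ^ 2 + 1 / real (k - i) ^ 2)"
    if "i \<in> {0<..<k}" for i
  proof -
    define a b where "a = real i" and "b = real (k - i)"
    have ab: "a > 0" "b > 0" "real k = a + b" using that by (auto simp: a_def b_def of_nat_diff)
    have "(a + b) ^ 2 \<le> 2 * (a ^ 2 + b ^ 2)"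
      using zero_le_power2[of "a - b"] by (simp add: power2_eq_square algebra_simps)
    then have "(a + b) ^ 2 / (a ^ 2 * b ^ 2 * (a + b) ^ 2) \<le> 2 * (a ^ 2 + b ^ 2) / (a ^ 2 * b ^ 2 * (a + b) ^ 2)"
      by (rule divide_right_mono) simp
    moreover have "2 * (a ^ 2 + b ^ 2) / (a ^ 2 * b ^ 2 * (a + b) ^ 2)
        = 2 / (a + b) ^ 2 * (1 / a ^ 2 + 1 / b ^ 2)"
      using ab by (simp add: field_simps)
    moreover have "(a + b) ^ 2 / (a ^ 2 * b ^ 2 * (a + b) ^ 2) = 1 / (a ^ 2 * b ^ 2)"
      using ab by simp
    ultimately show ?thesis unfolding a_def[symmetric] b_def[symmetric] ab(3) by simp
  qed
  then have "(\<Sum>i\<in>{0<..<k}. 1 / (real i ^ 2 * real (k - i) ^ 2))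
      \<le> (\<Sum>i\<in>{0<..<k}. 2 / real k ^ 2 * (1 / real i ^ 2 + 1 / real (k - i) ^ 2))"
    by (rule sum_mono)
  also have "\<dots> = 2 / real k ^ 2 * ((\<Sum>i\<in>{0<..<k}. 1 / real i ^ 2) + (\<Sum>i\<in>{0<..<k}. 1 / real (k - i) ^ 2))"
    by (simp add: sum_distrib_left sum.distrib distrib_left)
  also have "(\<Sum>i\<in>{0<..<k}. 1 / real (k - i) ^ 2) = (\<Sum>i\<in>{0<..<k}. 1 / real i ^ 2)"
    by (rule sum.reindex_bij_witness[of _ "\<lambda>i. k - i" "\<lambda>i. k - i"]) auto
  also have "2 / real k ^ 2 * ((\<Sum>i\<in>{0<..<k}. 1 / real i ^ 2) + (\<Sum>i\<in>{0<..<k}. 1 / real i ^ 2))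
      \<le> 2 / real k ^ 2 * (2 + 2)"
    using sum_inverse_squares_le[of k] by (intro mult_left_mono) auto
  finally show ?thesis by simp
qed simp

text \<open>The majorant is \<open>A * L ^ k / k ^ 2\<close>: the weight \<open>1 / k ^ 2\<close> makes the convolution of the majorant with
  itself a constant multiple of the majorant, and the constant is absorbed by a small \<open>A\<close>.\<close>

lemma quadratic_recursion_geometric_bound:
  fixes x :: "nat \<Rightarrow> real"
  assumes x0: "\<And>k. x k \<ge> 0" and C: "C \<ge> 0" "D \<ge> 0" "R > 0"
    and rec: "\<And>k. k > 0 \<Longrightarrow> x k \<le> C * (D * R ^ k + (\<Sum>i\<in>{0<..<k}. x i * x (k - i)))"
  obtains A L where "A > 0" "L > 0" "\<And>k. k > 0 \<Longrightarrow> x k \<le> A * L ^ k"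
proof -
  \<comment> \<open>\<open>A\<close> makes the convolution use up at most half of the majorant.
    \<open>\<mu>\<close> leaves the other half for the term \<open>D * R ^ k\<close>, and the factor
    4 in \<open>L\<close> pays for the weight through \<open>k ^ 2 \<le> 4 ^ k\<close>.\<close>
  define A where "A = 1 / (16 * (C + 1))"
  define \<mu> where "\<mu> = 1 + 2 * C * D / A"
  define L where "L = R * (4 * \<mu>)"
  have A: "A > 0" "8 * C * A \<le> 1 / 2" using C by (auto simp: A_def field_simps)
  have mu: "\<mu> \<ge> 1" "2 * C * D \<le> A * \<mu>" using A C by (auto simp: \<mu>_def field_simps)
  have L: "L > 0" using C mu by (simp add: L_def)
  have bound: "x k \<le> A * L ^ k / real k ^ 2" if "k > 0" for k
    using that
  proof (induction k rule: less_induct)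
    case (less k)
    have "(\<Sum>i\<in>{0<..<k}. x i * x (k - i))
        \<le> (\<Sum>i\<in>{0<..<k}. (A * L ^ i / real i ^ 2) * (A * L ^ (k - i) / real (k - i) ^ 2))"
      using less.IH A L x0 by (intro sum_mono mult_mono) (auto simp del: of_nat_diff)
    also have "\<dots> = (\<Sum>i\<in>{0<..<k}. A ^ 2 * L ^ k * (1 / (real i ^ 2 * real (k - i) ^ 2)))"
    proof (rule sum.cong[OF refl])
      fix i assume "i \<in> {0<..<k}"
      then have "L ^ k = L ^ i * L ^ (k - i)" by (simp flip: power_add)
      then show "(A * L ^ i / real i ^ 2) * (A * L ^ (k - i) / real (k - i) ^ 2) =
          A ^ 2 * L ^ k * (1 / (real i ^ 2 * real (k - i) ^ 2))"
        by (simp add: power2_eq_square)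
    qed
    also have "\<dots> \<le> A ^ 2 * L ^ k * (8 / real k ^ 2)"
      unfolding sum_distrib_left[symmetric] using L
      by (intro mult_left_mono inverse_square_convolution_le) auto
    finally have 1: "(\<Sum>i\<in>{0<..<k}. x i * x (k - i)) \<le> A ^ 2 * L ^ k * (8 / real k ^ 2)" .
    have "C * (A ^ 2 * L ^ k * (8 / real k ^ 2)) = (8 * C * A) * (A * L ^ k / real k ^ 2)"
      by (simp add: power2_eq_square)
    also have "\<dots> \<le> 1 / 2 * (A * L ^ k / real k ^ 2)"
      using A L by (intro mult_right_mono) auto
    finally have 2: "C * (\<Sum>i\<in>{0<..<k}. x i * x (k - i)) \<le> 1 / 2 * (A * L ^ k / real k ^ 2)"
      using mult_left_mono[OF 1 C(1)] by linarith
    have "real k ^ 2 \<le> (2 ^ k) ^ 2" 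
      by (intro power_mono) (auto intro: less_imp_le simp: of_nat_less_two_power)
    also have "\<dots> = 4 ^ k" by (simp flip: power_mult add: mult.commute[of k] power_mult)
    finally have "2 * C * D * real k ^ 2 \<le> A * \<mu> * 4 ^ k"
      using mu A C by (intro mult_mono[where b = "A * \<mu>"]) auto
    also have "\<dots> \<le> A * \<mu> ^ k * 4 ^ k"
      using A mu less.prems self_le_power[of \<mu> k] by auto
    finally have "2 * C * D * real k ^ 2 * R ^ k \<le> A * \<mu> ^ k * 4 ^ k * R ^ k"
      using C by (intro mult_right_mono) auto
    also have "\<dots> = A * L ^ k" by (simp add: L_def power_mult_distrib)
    finally have "C * (D * R ^ k) \<le> 1 / 2 * (A * L ^ k / real k ^ 2)"
      using less.prems by (simp add: field_simps)
    with 2 rec[OF less.prems] show ?case by (simp add: algebra_simps)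
  qed
  show ?thesis
  proof (rule that[OF A(1) L])
    fix k :: nat assume k: "k > 0"
    then have "A * L ^ k / real k ^ 2 \<le> A * L ^ k / 1"
      using A L by (intro divide_left_mono) auto
    with bound[OF k] show "x k \<le> A * L ^ k" by simp
  qed
qed

section \<open>Hensel factorization\<close>

text \<open>The l1 norm, cut off at \<open>n\<close>. The cut-off loses nothing on the slices of
  positive index in the Hensel recursion, which have degree below \<open>n\<close>, and it keeps the
  norm submultiplicative although products may have larger degree.\<close>

definition coeff_norm :: "nat \<Rightarrow> complex poly \<Rightarrow> real" where
  "coeff_norm n p = (\<Sum>i<n. cmod (coeff p i))"

lemma coeff_norm_nonneg [simp]: "coeff_norm n p \<ge> 0"
  by (simp add: coeff_norm_def sum_nonneg)

lemma coeff_norm_0 [simp]: "coeff_norm n 0 = 0"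
  by (simp add: coeff_norm_def)

lemma norm_coeff_le_coeff_norm: "i < n \<Longrightarrow> cmod (coeff p i) \<le> coeff_norm n p"
  unfolding coeff_norm_def by (rule member_le_sum) auto

lemma coeff_norm_add: "coeff_norm n (p + q) \<le> coeff_norm n p + coeff_norm n q"
  unfolding coeff_norm_def sum.distrib[symmetric] by (intro sum_mono) (simp add: norm_triangle_ineq)

lemma coeff_norm_diff: "coeff_norm n (p - q) \<le> coeff_norm n p + coeff_norm n q"
  unfolding coeff_norm_def sum.distrib[symmetric] by (intro sum_mono) (simp add: norm_triangle_ineq4)

lemma coeff_norm_smult: "coeff_norm n (smult c p) = cmod c * coeff_norm n p"
  by (simp add: coeff_norm_def norm_mult sum_distrib_left)

lemma coeff_norm_sum: "coeff_norm n (sum p A) \<le> (\<Sum>a\<in>A. coeff_norm n (p a))"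
  by (induction A rule: infinite_finite_induct)
     (auto intro: order_trans[OF coeff_norm_add])

lemma coeff_norm_mult: "coeff_norm n (p * q) \<le> coeff_norm n p * coeff_norm n q"
proof -
  have "coeff_norm n (p * q) \<le> (\<Sum>k<n. \<Sum>i\<le>k. cmod (coeff p i) * cmod (coeff q (k - i)))"
    unfolding coeff_norm_def coeff_mult
    by (intro sum_mono order_trans[OF norm_sum]) (simp add: norm_mult)
  also have "\<dots> = (\<Sum>(k, i)\<in>Sigma {..<n} (\<lambda>k. {..k}). cmod (coeff p i) * cmod (coeff q (k - i)))"
    by (subst sum.Sigma) auto
  also have "\<dots> = (\<Sum>(i, j)\<in>{(i, j). i + j < n}. cmod (coeff p i) * cmod (coeff q j))"
    by (rule sum.reindex_bij_witness[of _ "\<lambda>(i, j). (i + j, i)" "\<lambda>(k, i). (i, k - i)"]) auto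
  also have "\<dots> \<le> (\<Sum>(i, j)\<in>{..<n} \<times> {..<n}. cmod (coeff p i) * cmod (coeff q j))"
    by (intro sum_mono2) auto
  also have "\<dots> = coeff_norm n p * coeff_norm n q"
    by (simp add: coeff_norm_def sum_product sum.cartesian_product)
  finally show ?thesis .
qed

text \<open>A Bezout relation is multiplied by \<open>R\<close> and the cofactor of \<open>B\<close>
  is reduced modulo \<open>A\<close>; comparing coefficients at \<open>degree A + degree H\<close>
  then forces the other cofactor below \<open>degree B\<close>. Vanishing coefficients, unlike a
  strict inequality of degrees, also cover a constant \<open>A\<close> or \<open>B\<close>, where
  the corresponding cofactor is 0.\<close>

lemma coprime_bezout_degree:
  fixes A B R :: "'a::field_gcd poly"
  assumes "coprime A B" "A \<noteq> 0" "B \<noteq> 0" 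
    and R: "\<And>i. i \<ge> degree A + degree B \<Longrightarrow> coeff R i = 0"
  shows "\<exists>G H. A * H + B * G = R \<and> (\<forall>i\<ge>degree A. coeff G i = 0) \<and> (\<forall>i\<ge>degree B. coeff H i = 0)"
proof -
  obtain U V where UV: "U * A + V * B = 1"
    using bezout_coefficients_fst_snd[of A B] assms(1) by (auto simp: coprime_iff_gcd_eq_1)
  define G where "G = (R * V) mod A"
  define H where "H = R * U + (R * V) div A * B"
  have "A * H + B * G = R * U * A + B * (R * V div A * A + R * V mod A)"
    unfolding G_def H_def by algebra
  also have "\<dots> = R * (U * A + V * B)" by (simp only: div_mult_mod_eq) algebra
  finally have 1: "A * H + B * G = R" using UV by simp
  have G: "coeff G i = 0" if "i \<ge> degree A" for i
  proof (cases "G = 0")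
    case False
    then have "degree G < degree A"
      using degree_mod_less[OF assms(2), of "R * V"] by (auto simp: G_def)
    then show ?thesis using that by (simp add: coeff_eq_0)
  qed simp
  have H: "coeff H i = 0" if i: "i \<ge> degree B" for i
  proof (rule ccontr)
    assume "coeff H i \<noteq> 0"
    then have H0: "H \<noteq> 0" and dH: "degree H \<ge> degree B"
      using i le_degree[of H i] by auto
    have "coeff (A * H) (degree A + degree H) \<noteq> 0"
      using assms H0 by (simp add: coeff_mult_degree_sum)
    moreover have "coeff (B * G) (degree A + degree H) = 0"
    proof (cases "G = 0")
      case False
      then have "degree G < degree A" using G leading_coeff_neq_0 not_le by blast
      then have "degree (B * G) < degree A + degree H"
        using dH degree_mult_le[of B G] by linarith
      then show ?thesis by (rule coeff_eq_0)
    qed simp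
    moreover have "coeff R (degree A + degree H) = 0" using dH by (intro R) simp
    ultimately show False using 1 by (metis coeff_add add.right_neutral)
  qed
  show ?thesis using 1 G H by blast
qed

text \<open>The problem is solved once for each monomial below \<open>n\<close> and extended
  linearly in \<open>R\<close>. The constant thus depends on \<open>A\<close> and \<open>B\<close>
  only, so one \<open>C\<close> serves all steps of the Hensel recursion.\<close>

lemma coprime_bezout_bounded:
  fixes A B :: "complex poly"
  assumes "coprime A B" "A \<noteq> 0" "B \<noteq> 0" and n: "n = degree A + degree B"
  obtains C where "C \<ge> 0"
    "\<And>R. (\<And>i. i \<ge> n \<Longrightarrow> coeff R i = 0) \<Longrightarrow>
       \<exists>G H. A * H + B * G = R \<and> (\<forall>i\<ge>degree A. coeff G i = 0) \<and> (\<forall>i\<ge>degree B. coeff H i = 0) \<and>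
         coeff_norm n G + coeff_norm n H \<le> C * coeff_norm n R"
proof -
  have "\<exists>G H. A * H + B * G = monom 1 j \<and> (\<forall>i\<ge>degree A. coeff G i = 0) \<and> (\<forall>i\<ge>degree B. coeff H i = 0)"
    if "j < n" for j
  proof -
    have "coeff (monom 1 j) i = (0::complex)" if "i \<ge> degree A + degree B" for i
      using that \<open>j < n\<close> n by simp
    then show ?thesis by (intro coprime_bezout_degree assms)
  qed
  then obtain G H where GH: "\<And>j. j < n \<Longrightarrow> A * H j + B * G j = monom 1 j"
    "\<And>j i. j < n \<Longrightarrow> i \<ge> degree A \<Longrightarrow> coeff (G j) i = 0"
    "\<And>j i. j < n \<Longrightarrow> i \<ge> degree B \<Longrightarrow> coeff (H j) i = 0" by metis
  define C where "C = (\<Sum>j<n. coeff_norm n (G j) + coeff_norm n (H j))"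
  show ?thesis
  proof (rule that[of C])
    show "C \<ge> 0" by (simp add: C_def sum_nonneg)
    fix R :: "complex poly" assume R: "\<And>i. i \<ge> n \<Longrightarrow> coeff R i = 0"
    define G' where "G' = (\<Sum>j<n. smult (coeff R j) (G j))"
    define H' where "H' = (\<Sum>j<n. smult (coeff R j) (H j))"
    have "A * H' + B * G' = (\<Sum>j<n. smult (coeff R j) (A * H j + B * G j))"
      by (simp add: G'_def H'_def sum_distrib_left sum.distrib smult_add_right)
    also have "\<dots> = (\<Sum>j<n. monom (coeff R j) j)"
      using GH(1) by (simp add: smult_monom)
    also have "\<dots> = R"
      using R by (intro poly_eqI) (auto simp: coeff_sum not_less)
    finally have 1: "A * H' + B * G' = R" .
    have "coeff_norm n G' + coeff_norm n H' \<le>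
        (\<Sum>j<n. cmod (coeff R j) * (coeff_norm n (G j) + coeff_norm n (H j)))"
      unfolding G'_def H'_def distrib_left sum.distrib
      by (intro add_mono order_trans[OF coeff_norm_sum] sum_mono) (simp_all add: coeff_norm_smult)
    also have "\<dots> \<le> (\<Sum>j<n. cmod (coeff R j) * C)"
      unfolding C_def by (intro sum_mono mult_left_mono member_le_sum) auto
    also have "\<dots> = C * coeff_norm n R"
      by (simp add: coeff_norm_def sum_distrib_left mult.commute)
    finally have 2: "coeff_norm n G' + coeff_norm n H' \<le> C * coeff_norm n R" .
    have "\<forall>i\<ge>degree A. coeff G' i = 0" "\<forall>i\<ge>degree B. coeff H' i = 0"
      using GH(2,3) by (auto simp: G'_def H'_def coeff_sum)
    with 1 2 show "\<exists>G H. A * H + B * G = R \<and> (\<forall>i\<ge>degree A. coeff G i = 0) \<and>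
        (\<forall>i\<ge>degree B. coeff H i = 0) \<and> coeff_norm n G + coeff_norm n H \<le> C * coeff_norm n R"
      by blast
  qed
qed

text \<open>A polynomial over \<open>complex fps\<close> is regarded as a power series with polynomial coefficients, the slices.\<close>

definition fps_slice :: "complex fps poly \<Rightarrow> nat \<Rightarrow> complex poly" where
  "fps_slice P k = map_poly (\<lambda>a. a $ k) P"

lemma coeff_fps_slice [simp]: "coeff (fps_slice P k) j = coeff P j $ k"
  by (simp add: fps_slice_def coeff_map_poly)

definition convergent_poly :: "complex fps poly \<Rightarrow> bool" where
  "convergent_poly P \<longleftrightarrow> (\<forall>i. convergent_fps (coeff P i))"

text \<open>All slices of positive index stay below degree \<open>m\<close>, so the monic zeroth
  slice fixes the degree and the leading coefficient.\<close>

lemma poly_from_slices: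
  fixes s :: "nat \<Rightarrow> complex poly"
  assumes "degree (s 0) = m" "lead_coeff (s 0) = 1" "\<And>k i. k > 0 \<Longrightarrow> i \<ge> m \<Longrightarrow> coeff (s k) i = 0"
  obtains G where "degree G = m" "lead_coeff G = 1" "\<And>k. fps_slice G k = s k"
proof -
  define G where "G = Poly (map (\<lambda>j. Abs_fps (\<lambda>k. coeff (s k) j)) [0..<Suc m])"
  have c: "coeff G j = Abs_fps (\<lambda>k. coeff (s k) j)" for j
  proof (cases "j \<le> m")
    case True
    then show ?thesis by (simp add: G_def nth_default_def del: upt_Suc)
  next
    case False
    then have "coeff (s k) j = 0" for k
      using assms by (cases k) (auto simp: coeff_eq_0)
    with False show ?thesis by (simp add: G_def nth_default_def fps_eq_iff del: upt_Suc)
  qed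
  have cm: "coeff G m = 1"
    unfolding c using assms by (auto simp: fps_eq_iff)
  have d: "degree G = m"
  proof (rule antisym)
    have "coeff (s k) i = 0" if "i > m" for i k
      using assms that by (cases k) (auto simp: coeff_eq_0)
    then show "degree G \<le> m" by (intro degree_le) (auto simp: c fps_eq_iff)
    show "m \<le> degree G" using cm by (intro le_degree) simp
  qed
  show ?thesis by (rule that[of G]) (use d cm in \<open>auto simp: poly_eq_iff c\<close>)
qed

lemma fps_slice_mult: "fps_slice (P * Q) k = (\<Sum>i\<le>k. fps_slice P i * fps_slice Q (k - i))"
proof (rule poly_eqI)
  fix j
  have "coeff (fps_slice (P * Q) k) j = (\<Sum>a\<le>j. \<Sum>i=0..k. coeff P a $ i * coeff Q (j - a) $ (k - i))"
    by (simp add: coeff_mult fps_sum_nth fps_mult_nth)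
  also have "\<dots> = (\<Sum>i=0..k. \<Sum>a\<le>j. coeff P a $ i * coeff Q (j - a) $ (k - i))"
    by (rule sum.swap)
  finally show "coeff (fps_slice (P * Q) k) j = coeff (\<Sum>i\<le>k. fps_slice P i * fps_slice Q (k - i)) j"
    by (simp add: coeff_sum coeff_mult atMost_atLeast0)
qed

lemma fps_slice_inject: "(\<And>k. fps_slice P k = fps_slice Q k) \<Longrightarrow> P = Q"
  by (intro poly_eqI fps_ext) (metis coeff_fps_slice)

text \<open>At \<open>X ^ k\<close> the equation \<open>P = G * H\<close> reads
  \<open>A * H_k + B * G_k = P_k\<close> minus the sum of \<open>G_i * H_(k - i)\<close> over
  \<open>0 < i < k\<close>, which is solvable by coprimality. Since the solutions are bounded
  linearly, the norms of the slices satisfy a quadratic recursion and grow at most geometrically,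
  which is convergence.\<close>

theorem hensel_factorization:
  fixes P :: "complex fps poly"
  assumes P: "convergent_poly P" "lead_coeff P = 1"
    and AB: "fps_slice P 0 = A * B" "coprime A B" "lead_coeff A = 1" "lead_coeff B = 1"
  obtains G H where "P = G * H" "degree G = degree A" "lead_coeff G = 1" "convergent_poly G"
proof -
  define n where "n = degree A + degree B"
  have AB0: "A \<noteq> 0" "B \<noteq> 0" using AB by auto
  have dP: "degree P = n"
  proof -
    have "coeff (fps_slice P 0) (degree P) \<noteq> 0" using P by simp
    moreover have "degree (fps_slice P 0) \<le> degree P"
      by (intro degree_le) (auto simp: coeff_eq_0)
    ultimately have "degree (fps_slice P 0) = degree P"
      by (intro antisym[OF _ le_degree])
    then show ?thesis using AB AB0 by (simp add: n_def degree_mult_eq)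
  qed
  obtain C where C: "C \<ge> 0" and solve: "\<And>R. (\<And>i. i \<ge> n \<Longrightarrow> coeff R i = 0) \<Longrightarrow>
       \<exists>G H. A * H + B * G = R \<and> (\<forall>i\<ge>degree A. coeff G i = 0) \<and> (\<forall>i\<ge>degree B. coeff H i = 0) \<and>
         coeff_norm n G + coeff_norm n H \<le> C * coeff_norm n R"
    using coprime_bezout_bounded[OF AB(2) AB0 n_def] by blast
  define rest where "rest s k = fps_slice P k - (\<Sum>i\<in>{0<..<k}. fst (s i) * snd (s (k - i)))"
    for s :: "nat \<Rightarrow> complex poly \<times> complex poly" and k
  \<comment> \<open>The value at \<open>k\<close> depends on all earlier ones and has to be chosen
    together with its norm bound, so all conditions are packed into one predicate for dependent
    choice along the well-order.\<close>
  define ok where "ok s k r \<longleftrightarrow> (if k = 0 then r = (A, B) else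
      A * snd r + B * fst r = rest s k \<and> (\<forall>i\<ge>degree A. coeff (fst r) i = 0) \<and>
      (\<forall>i\<ge>degree B. coeff (snd r) i = 0) \<and>
      coeff_norm n (fst r) + coeff_norm n (snd r) \<le> C * coeff_norm n (rest s k))" for s k r
  have "\<exists>s. \<forall>k. ok s k (s k)"
  proof (rule dependent_wellorder_choice)
    fix r s s' and k :: nat
    assume eq: "\<And>y. y < k \<Longrightarrow> s y = (s' y :: complex poly \<times> complex poly)"
    have "rest s k = rest s' k" unfolding rest_def by (simp add: eq)
    then show "ok s k r = ok s' k r" by (simp add: ok_def)
  next
    fix k and s :: "nat \<Rightarrow> complex poly \<times> complex poly"
    assume IH: "\<And>y. y < k \<Longrightarrow> ok s y (s y)"
    show "\<exists>r. ok s k r"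
    proof (cases "k = 0")
      case False
      \<comment> \<open>The leading coefficient of \<open>P\<close> is the constant 1 and
        contributes nothing at \<open>k > 0\<close>; in the products, every index
        \<open>i \<ge> n\<close> meets a vanishing coefficient of one factor.\<close>
      have "coeff (rest s k) i = 0" if i: "i \<ge> n" for i
      proof -
        have "coeff P i $ k = 0"
          using False P(2) dP i by (cases "i = n") (auto simp: coeff_eq_0)
        moreover have "coeff (fst (s a) * snd (s (k - a))) i = 0" if a: "a \<in> {0<..<k}" for a
        proof -
          have "coeff (fst (s a)) j * coeff (snd (s (k - a))) (i - j) = 0" if "j \<le> i" for j
          proof (cases "j \<ge> degree A")
            case True
            then show ?thesis using IH[of a] a by (simp add: ok_def)
          next
            case False
            then have "i - j \<ge> degree B" using i by (simp add: n_def)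
            then show ?thesis using IH[of "k - a"] a by (simp add: ok_def)
          qed
          then show ?thesis unfolding coeff_mult by (intro sum.neutral) blast
        qed
        ultimately show ?thesis by (simp add: rest_def coeff_sum)
      qed
      from solve[OF this] False show ?thesis by (auto simp: ok_def)
    qed (simp add: ok_def)
  qed
  then obtain s where s: "\<And>k. ok s k (s k)" by blast
  have s0: "s 0 = (A, B)" using s[of 0] by (simp add: ok_def)
  obtain G where G: "degree G = degree A" "lead_coeff G = 1" "\<And>k. fps_slice G k = fst (s k)"
  proof (rule poly_from_slices[of "\<lambda>k. fst (s k)" "degree A"])
    show "coeff (fst (s k)) i = 0" if "k > 0" "i \<ge> degree A" for k i
      using s[of k] that by (simp add: ok_def)
  qed (use s0 AB in auto)
  obtain H where H: "degree H = degree B" "lead_coeff H = 1" "\<And>k. fps_slice H k = snd (s k)"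
  proof (rule poly_from_slices[of "\<lambda>k. snd (s k)" "degree B"])
    show "coeff (snd (s k)) i = 0" if "k > 0" "i \<ge> degree B" for k i
      using s[of k] that by (simp add: ok_def)
  qed (use s0 AB in auto)
  have "fps_slice P k = fps_slice (G * H) k" for k
  proof (cases "k = 0")
    case True
    then show ?thesis using AB s0 by (simp add: fps_slice_mult G H)
  next
    case False
    have "{..k} = insert 0 (insert k {0<..<k})" using False by auto
    then have "fps_slice (G * H) k = A * snd (s k) + fst (s k) * B +
        (\<Sum>i\<in>{0<..<k}. fst (s i) * snd (s (k - i)))"
      using False s0 by (simp add: fps_slice_mult G H)
    also have "A * snd (s k) + fst (s k) * B = rest s k"
      using s[of k] False by (simp add: ok_def mult.commute)
    finally show ?thesis by (simp add: rest_def)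
  qed
  then have PGH: "P = G * H" by (rule fps_slice_inject)
  obtain D R where D: "D \<ge> 0" "R > 0" "\<And>a i. a \<in> {..<n} \<Longrightarrow> cmod (coeff P a $ i) \<le> D * R ^ i"
    using convergent_fps_bound_common[of "{..<n}" "coeff P"] P(1)
    unfolding convergent_poly_def by blast
  define x where "x k = coeff_norm n (fst (s k)) + coeff_norm n (snd (s k))" for k
  have "x k \<le> C * (real n * D * R ^ k + (\<Sum>i\<in>{0<..<k}. x i * x (k - i)))" if k: "k > 0" for k
  proof -
    have "x k \<le> C * coeff_norm n (rest s k)"
      using s[of k] k by (simp add: ok_def x_def)
    also have "coeff_norm n (rest s k) \<le> coeff_norm n (fps_slice P k) +
        (\<Sum>i\<in>{0<..<k}. coeff_norm n (fst (s i) * snd (s (k - i))))"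
      unfolding rest_def by (intro order_trans[OF coeff_norm_diff] add_left_mono coeff_norm_sum)
    also have "coeff_norm n (fps_slice P k) \<le> (\<Sum>i<n. D * R ^ k)"
      unfolding coeff_norm_def using D by (intro sum_mono) auto
    also have "(\<Sum>i<n. D * R ^ k) = real n * D * R ^ k" by simp
    also have "(\<Sum>i\<in>{0<..<k}. coeff_norm n (fst (s i) * snd (s (k - i)))) \<le> (\<Sum>i\<in>{0<..<k}. x i * x (k - i))"
      unfolding x_def by (intro sum_mono order_trans[OF coeff_norm_mult] mult_mono) auto
    finally show ?thesis using C by (simp add: mult_left_mono)
  qed
  then obtain X L where XL: "X > 0" "L > 0" "\<And>k. k > 0 \<Longrightarrow> x k \<le> X * L ^ k"
    using quadratic_recursion_geometric_bound[of x C "real n * D" R] C D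
    by (auto simp: x_def)
  have "convergent_fps (coeff G j)" for j
  proof (cases "j < degree A")
    case True
    then have j: "j < n" by (simp add: n_def)
    show ?thesis
    proof (rule convergent_fpsI)
      fix i
      have c: "coeff G j $ i = coeff (fst (s i)) j" using G(3)[of i] by (metis coeff_fps_slice)
      show "cmod (coeff G j $ i) \<le> (X + cmod (coeff A j)) * L ^ i"
      proof (cases "i = 0")
        case True
        then show ?thesis unfolding c using s0 XL(1) by simp
      next
        case False
        have "cmod (coeff (fst (s i)) j) \<le> x i"
          using norm_coeff_le_coeff_norm[OF j, of "fst (s i)"] coeff_norm_nonneg[of n "snd (s i)"]
          unfolding x_def by linarith
        also have "\<dots> \<le> X * L ^ i" using False by (intro XL) simp
        also have "\<dots> \<le> (X + cmod (coeff A j)) * L ^ i" using XL by (intro mult_right_mono) auto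
        finally show ?thesis by (simp add: c)
      qed
    qed
  next
    case False
    then show ?thesis using G(1,2) by (cases "j = degree A") (auto simp: coeff_eq_0)
  qed
  then have "convergent_poly G" by (simp add: convergent_poly_def)
  with PGH G show ?thesis using that by blast
qed

section \<open>Existence of a convergent Puiseux root\<close>

lemma poly_eq_sum_le:
  fixes P :: "'a::comm_ring_1 poly"
  assumes "degree P \<le> n"
  shows "poly P x = (\<Sum>i\<le>n. coeff P i * x ^ i)"
  unfolding poly_altdef using assms
  by (intro sum.mono_neutral_left) (auto simp: coeff_eq_0)

section \<open>The substitution \<open>X := X ^ N\<close>, which brings different ramifications to a
  common variable\<close>

abbreviation ramify :: "nat \<Rightarrow> 'a::{comm_ring_1,idom} fps \<Rightarrow> 'a fps" where
  "ramify N p \<equiv> p oo fps_X ^ N"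

lemma ramify_mult: "N > 0 \<Longrightarrow> ramify N (p * q) = ramify N p * ramify N q"
  by (intro fps_compose_mult_distrib) (simp add: power_0_left)

lemma ramify_power: "N > 0 \<Longrightarrow> ramify N (p ^ k) = ramify N p ^ k"
  by (intro fps_compose_power[symmetric]) simp

lemma ramify_X_power: "N > 0 \<Longrightarrow> ramify N (fps_X ^ k) = fps_X ^ (N * k)"
  by (simp add: ramify_power fps_X_fps_compose_startby0 power_mult)

lemma ramify_ramify: "N > 0 \<Longrightarrow> M > 0 \<Longrightarrow> ramify N (ramify M p) = ramify (M * N) p"
  by (intro fps_ext) (auto simp: fps_nth_compose_X_power div_mult2_eq mult.commute
      dvd_mult_div_cancel elim!: dvdE)

lemma ramify_eq_0_iff: "N > 0 \<Longrightarrow> ramify N p = 0 \<longleftrightarrow> p = 0"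
proof
  assume "N > 0" "ramify N p = 0"
  then have "ramify N p $ (N * i) = 0" for i by simp
  with \<open>N > 0\<close> show "p = 0" by (auto simp: fps_eq_iff fps_nth_compose_X_power)
qed simp

definition ramify_poly :: "nat \<Rightarrow> complex fps poly \<Rightarrow> complex fps poly" where
  "ramify_poly N P = map_poly (ramify N) P"

lemma coeff_ramify_poly [simp]: "coeff (ramify_poly N P) i = ramify N (coeff P i)"
  by (simp add: ramify_poly_def coeff_map_poly)

lemma ramify_poly_0 [simp]: "ramify_poly N 0 = 0"
  by (simp add: poly_eq_iff)

lemma ramify_poly_add: "ramify_poly N (P + Q) = ramify_poly N P + ramify_poly N Q"
  by (simp add: poly_eq_iff fps_compose_add_distrib)

lemma ramify_poly_mult: "N > 0 \<Longrightarrow> ramify_poly N (P * Q) = ramify_poly N P * ramify_poly N Q"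
  by (simp add: poly_eq_iff coeff_mult fps_compose_sum_distrib ramify_mult)

lemma ramify_poly_pCons: "ramify_poly N (pCons a P) = pCons (ramify N a) (ramify_poly N P)"
  by (simp add: poly_eq_iff coeff_pCons split: nat.split)

lemma ramify_poly_pcompose:
  "N > 0 \<Longrightarrow> ramify_poly N (pcompose P Q) = pcompose (ramify_poly N P) (ramify_poly N Q)"
  by (induction P) (simp_all add: pcompose_pCons ramify_poly_add ramify_poly_mult ramify_poly_pCons)

lemma degree_ramify_poly: "N > 0 \<Longrightarrow> degree (ramify_poly N P) = degree P"
  unfolding ramify_poly_def by (rule degree_map_poly) (simp add: ramify_eq_0_iff)

lemma poly_ramify_poly: "N > 0 \<Longrightarrow> poly (ramify_poly N P) (ramify N p) = ramify N (poly P p)"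
  by (induction P) (simp_all add: ramify_poly_pCons fps_compose_add_distrib ramify_mult)

lemma ramify_poly_ramify_poly:
  "N > 0 \<Longrightarrow> M > 0 \<Longrightarrow> ramify_poly N (ramify_poly M P) = ramify_poly (M * N) P"
  by (simp add: poly_eq_iff ramify_ramify)

text \<open>The explicit binomial form serves twice: it shows that a shift preserves convergence,
  and that the Tschirnhaus shift cancels the coefficient at \<open>n - 1\<close>.\<close>

lemma coeff_pcompose_linear:
  fixes P :: "'a::idom poly"
  shows "coeff (pcompose P [:c, 1:]) j = (\<Sum>i\<le>degree P. coeff P i * (of_nat (i choose j) * c ^ (i - j)))"
proof -
  have "pcompose P [:c, 1:] = (\<Sum>i\<le>degree P. [:coeff P i:] * [:c, 1:] ^ i)"
    unfolding pcompose_altdef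
    by (subst poly_eq_sum_le[of _ "degree P"]) (auto simp: coeff_map_poly coeff_eq_0 intro: degree_le)
  moreover have "coeff ([:c, 1:] ^ i) j = of_nat (i choose j) * c ^ (i - j)" for i
    by (cases "j \<le> i") (auto simp: coeff_linear_poly_power coeff_eq_0 degree_linear_power binomial_eq_0)
  ultimately show ?thesis by (simp add: coeff_sum)
qed

lemma lead_coeff_pcompose_linear: "lead_coeff (pcompose (P :: 'a::idom poly) [:c, 1:]) = lead_coeff P"
  by (subst lead_coeff_comp) auto

lemma degree_pcompose_linear: "degree (pcompose (P :: 'a::idom poly) [:c, 1:]) = degree P"
  by (simp add: degree_pcompose)

lemma convergent_poly_pcompose_linear:
  assumes "convergent_poly P" "convergent_fps c"
  shows "convergent_poly (pcompose P [:c, 1:])"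
  using assms unfolding convergent_poly_def coeff_pcompose_linear
  by (auto intro!: convergent_fps_sum convergent_fps_mult convergent_fps_power)

text \<open>\<open>P(X ^ w)\<close> and \<open>Q\<close> are related by \<open>P(X ^ w)(X ^ u * Y) = X ^ (n * u) * Q(Y)\<close>.\<close>

lemma poly_scale:
  fixes P Q :: "complex fps poly"
  assumes "degree P = n" "degree Q = n" "w > 0"
    and "\<And>i. i \<le> n \<Longrightarrow> ramify w (coeff P i) = fps_X ^ (u * (n - i)) * coeff Q i"
    and "N > 0" "poly (ramify_poly N Q) q = 0"
  shows "poly (ramify_poly (w * N) P) (fps_X ^ (N * u) * q) = 0"
proof -
  have "poly (ramify_poly (w * N) P) (fps_X ^ (N * u) * q)
      = (\<Sum>i\<le>n. ramify (w * N) (coeff P i) * (fps_X ^ (N * u) * q) ^ i)"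
    using assms by (subst poly_eq_sum_le[of _ n]) (auto simp: degree_ramify_poly)
  also have "\<dots> = (\<Sum>i\<le>n. fps_X ^ (N * u * n) * (ramify N (coeff Q i) * q ^ i))"
  proof (rule sum.cong[OF refl])
    fix i assume "i \<in> {..n}"
    then have i: "i \<le> n" by simp
    have "ramify (w * N) (coeff P i) = ramify N (ramify w (coeff P i))"
      using assms by (simp add: ramify_ramify)
    also have "\<dots> = fps_X ^ (N * (u * (n - i))) * ramify N (coeff Q i)"
      using assms i by (simp add: ramify_mult ramify_X_power)
    finally have "ramify (w * N) (coeff P i) * (fps_X ^ (N * u) * q) ^ i
        = (fps_X ^ (N * (u * (n - i))) * fps_X ^ (N * u * i)) * (ramify N (coeff Q i) * q ^ i)"
      unfolding power_mult_distrib power_mult[of fps_X "N * u" i, symmetric] by (simp only: mult_ac)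
    also have "fps_X ^ (N * (u * (n - i))) * fps_X ^ (N * u * i) = (fps_X ^ (N * u * n) :: complex fps)"
      using i by (simp flip: power_add add: algebra_simps diff_mult_distrib2)
    finally show "ramify (w * N) (coeff P i) * (fps_X ^ (N * u) * q) ^ i
        = fps_X ^ (N * u * n) * (ramify N (coeff Q i) * q ^ i)" .
  qed
  also have "\<dots> = fps_X ^ (N * u * n) * poly (ramify_poly N Q) q"
    using assms by (subst poly_eq_sum_le[of _ n]) (auto simp: degree_ramify_poly sum_distrib_left)
  finally show ?thesis using assms by simp
qed

lemma hensel_split:
  fixes Q :: "complex fps poly"
  assumes Q: "convergent_poly Q" "lead_coeff Q = 1" "degree Q = n" "n > 1"
    and "coeff Q (n - 1) = 0" "k < n" "coeff Q k $ 0 \<noteq> 0"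
  obtains G H where "Q = G * H" "degree G > 0" "degree G < n" "lead_coeff G = 1" "convergent_poly G"
proof -
  define S where "S = fps_slice Q 0"
  have Sn: "coeff S n = 1" using Q by (simp add: S_def)
  have dS: "degree S = n"
  proof (rule antisym)
    show "degree S \<le> n" using Q by (intro degree_le) (auto simp: S_def coeff_eq_0)
    show "n \<le> degree S" using Sn by (intro le_degree) simp
  qed
  have S0: "S \<noteq> 0" using Sn by auto
  have "\<not> constant (poly S)" using dS Q(4) by (simp add: constant_degree)
  then obtain c where c: "poly S c = 0" using fundamental_theorem_of_algebra by blast
  define m where "m = order c S"
  obtain B where B: "S = [:-c, 1:] ^ m * B" "\<not> [:-c, 1:] dvd B"
    using order_decomp[OF S0, of c] unfolding m_def by blast
  define A where "A = [:-c, 1:] ^ m"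
  have m: "m > 0" using c S0 by (simp add: m_def order_gt_0_iff)
  have dA: "degree A = m" "lead_coeff A = 1"
    unfolding A_def lead_coeff_power by (simp_all add: degree_linear_power)
  have B0: "B \<noteq> 0" using B by auto
  have lB: "lead_coeff B = 1"
    using B Sn dS dA(2) lead_coeff_mult[of A B] by (simp add: A_def)
  have dn: "n = m + degree B"
    using B dS B0 dA degree_mult_eq[of A B] by (auto simp: A_def)
  \<comment> \<open>An \<open>n\<close>-th power of \<open>Y - c\<close> has the coefficient
    \<open>- n * c\<close> at \<open>n - 1\<close>. Its vanishing gives \<open>c = 0\<close>, and
    then the coefficient at \<open>k\<close> vanishes too.\<close>
  have "m \<noteq> n"
  proof
    assume mn: "m = n"
    then have "degree B = 0" using dn by simp
    then obtain b where "B = [:b:]" by (rule degree_eq_zeroE)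
    then have "B = 1" using lB by simp
    then have S: "S = [:-c, 1:] ^ n" using B mn by simp
    then have "coeff S (n - 1) = of_nat (n choose (n - 1)) * (- c) ^ (n - (n - 1))"
      by (simp add: coeff_linear_poly_power)
    moreover have "coeff S (n - 1) = 0" using assms by (simp add: S_def)
    ultimately have "c = 0" using Q(4) by (auto simp: binomial_eq_0_iff)
    then have "coeff S k = 0" using assms(6) by (simp add: S coeff_linear_poly_power)
    then show False using assms by (simp add: S_def)
  qed
  then have "m < n" using dn by simp
  have "coprime [:-c, 1:] B"
  proof (rule prime_elem_imp_coprime)
    show "prime_elem [:-c, 1:]"
      by (intro irreducible_imp_prime_elem irreducible_linear_field_poly) simp
  qed (use B in auto)
  then have "coprime A B" by (simp add: A_def)
  moreover have "fps_slice Q 0 = A * B" using B by (simp add: S_def A_def)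
  ultimately obtain G H where "Q = G * H" "degree G = degree A" "lead_coeff G = 1" "convergent_poly G"
    using hensel_factorization[OF Q(1,2)] dA lB by metis
  then show ?thesis using that m \<open>m < n\<close> dA by metis
qed

text \<open>After a Tschirnhaus shift and a rescaling by the smallest slope, the reduction modulo \<open>X\<close> has degree
  \<open>n\<close>, vanishing coefficient at \<open>n - 1\<close> and a nonzero lower coefficient, so it is no \<open>n\<close>-th power of a
  linear polynomial and Hensel factorization lowers the degree.\<close>

theorem puiseux_root_exists:
  assumes "convergent_poly P" "lead_coeff P = 1" "degree P > 0"
  shows "\<exists>N>0. \<exists>p. convergent_fps p \<and> poly (ramify_poly N P) p = 0"
  using assms
proof (induction "degree P" arbitrary: P rule: less_induct)
  case less
  define n where "n = degree P"
  have n: "n > 0" using less.prems by (simp add: n_def)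
  define c where "c = fps_const (1 / of_nat n) * coeff P (n - 1)"
  define T where "T = pcompose P [:-c, 1:]"
  have c: "convergent_fps c"
    using less.prems unfolding c_def convergent_poly_def by (intro convergent_fps_mult) auto
  have "lead_coeff T = lead_coeff P"
    unfolding T_def by (rule lead_coeff_pcompose_linear)
  then have T: "convergent_poly T" "lead_coeff T = 1" "degree T = n"
    using less.prems c unfolding T_def n_def
    by (auto intro: convergent_poly_pcompose_linear simp: degree_pcompose_linear)
  have Tn1: "coeff T (n - 1) = 0"
  proof -
    define t where "t i = coeff P i * (of_nat (i choose (n - 1)) * (- c) ^ (i - (n - 1)))" for i
    have "coeff T (n - 1) = (\<Sum>i\<le>n. t i)"
      unfolding T_def coeff_pcompose_linear n_def[symmetric] t_def ..
    also have "\<dots> = (\<Sum>i\<in>{n - 1, n}. t i)"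
      using n by (intro sum.mono_neutral_right) (auto simp: t_def binomial_eq_0)
    also have "\<dots> = t (n - 1) + t n" using n by simp
    also have "\<dots> = coeff P (n - 1) - of_nat n * c"
      using n less.prems(2) binomial_symmetric[of "n - 1" n] by (simp add: n_def t_def)
    also have "of_nat n * c = coeff P (n - 1)"
      using n by (simp add: c_def fps_of_nat[symmetric] mult.assoc[symmetric] fps_const_mult[symmetric] del: fps_const_mult)
    finally show ?thesis by simp
  qed
  have "\<exists>N>0. \<exists>p. convergent_fps p \<and> poly (ramify_poly N T) p = 0"
  proof (cases "\<forall>i<n. coeff T i = 0")
    case True
    have "poly (ramify_poly 1 T) 0 = 0" using True n by (simp add: poly_0_coeff_0)
    then show ?thesis by (intro exI[of _ 1] exI[of _ 0] conjI) auto
  next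
    case False
    define I where "I = {i. i < n \<and> coeff T i \<noteq> 0}"
    have I: "finite I" "I \<noteq> {}" using False by (auto simp: I_def)
    \<comment> \<open>Newton polygon: \<open>k\<close> minimizes the slope \<open>u / w\<close>.
      After \<open>X := X ^ w\<close> the coefficient at \<open>i\<close> has order at least
      \<open>u * (n - i)\<close>, with equality at \<open>k\<close>, so dividing by these powers of
      \<open>X\<close> leaves a nonzero constant term at \<open>k\<close>.\<close>
    define slope where "slope i = real (subdegree (coeff T i)) / real (n - i)" for i
    obtain k where k: "k \<in> I" "\<And>i. i \<in> I \<Longrightarrow> slope k \<le> slope i"
      using arg_min_least[OF I] arg_min_if_finite(1)[OF I] by metis
    define u where "u = subdegree (coeff T k)"
    define w where "w = n - k"
    have kn: "k < n" "coeff T k \<noteq> 0" using k by (auto simp: I_def)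
    then have w: "w > 0" by (simp add: w_def)
    have le: "u * (n - i) \<le> subdegree (coeff T i) * w" if "i \<in> I" for i
    proof -
      have "i < n" using that by (simp add: I_def)
      then have "real u * real (n - i) \<le> real (subdegree (coeff T i)) * real w"
        using k(2)[OF that] kn by (simp add: slope_def u_def w_def field_simps)
      then show ?thesis by (metis of_nat_le_iff of_nat_mult)
    qed
    define Q where "Q = Poly (map (\<lambda>i. fps_shift (u * (n - i)) (ramify w (coeff T i))) [0..<Suc n])"
    have cQ: "coeff Q i = (if i \<le> n then fps_shift (u * (n - i)) (ramify w (coeff T i)) else 0)" for i
      by (auto simp: Q_def nth_default_def simp del: upt_Suc)
    have TQ: "ramify w (coeff T i) = fps_X ^ (u * (n - i)) * coeff Q i" if "i \<le> n" for i
    proof (cases "i \<in> I")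
      case True
      then have "u * (n - i) \<le> subdegree (ramify w (coeff T i))"
        using le[OF True] w by simp
      then have "fps_shift (u * (n - i)) (ramify w (coeff T i)) * fps_X ^ (u * (n - i)) = ramify w (coeff T i)"
        by (rule fps_shift_times_fps_X_power)
      then show ?thesis using that cQ by (metis mult.commute)
    next
      case False
      then show ?thesis using that T by (cases "i = n") (auto simp: cQ I_def)
    qed
    have Qn: "coeff Q n = 1" using T by (simp add: cQ)
    have dQ: "degree Q = n"
      using Qn by (intro antisym degree_le le_degree) (auto simp: cQ)
    have lQ: "lead_coeff Q = 1" using Qn dQ by simp
    have convQ: "convergent_poly Q"
      using T(1) w unfolding convergent_poly_def cQ by (auto intro: convergent_fps_compose_X_power)
    have Qn1: "coeff Q (n - 1) = 0" using Tn1 by (simp add: cQ)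
    have Qk: "coeff Q k $ 0 \<noteq> 0"
      using kn w by (simp add: cQ fps_nth_compose_X_power u_def w_def)
    \<comment> \<open>For \<open>n = 1\<close> the only candidate \<open>k = 0\<close> equals
      \<open>n - 1\<close>, where the shift has cancelled the coefficient.\<close>
    have "n > 1"
    proof (rule ccontr)
      assume "\<not> n > 1"
      then have "k = n - 1" using kn by simp
      then show False using kn Tn1 by simp
    qed
    then obtain G H where G: "Q = G * H" "degree G > 0" "degree G < n" "lead_coeff G = 1" "convergent_poly G"
      using hensel_split[OF convQ lQ dQ _ Qn1 kn(1) Qk] by blast
    obtain N p where Np: "N > 0" "convergent_fps p" "poly (ramify_poly N G) p = 0"
      using less.hyps[of G] G unfolding n_def by blast
    then have "poly (ramify_poly N Q) p = 0" by (simp add: G ramify_poly_mult)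
    then have "poly (ramify_poly (w * N) T) (fps_X ^ (N * u) * p) = 0"
      using poly_scale[OF T(3) dQ w TQ Np(1)] by blast
    moreover have "convergent_fps (fps_X ^ (N * u) * p)"
      using Np by (intro convergent_fps_mult) auto
    ultimately show ?thesis using w Np by (intro exI[of _ "w * N"] conjI) auto
  qed
  then obtain N p where Np: "N > 0" "convergent_fps p" "poly (ramify_poly N T) p = 0" by blast
  have "poly (ramify_poly N P) (p - ramify N c) = 0"
    using Np by (simp add: T_def ramify_poly_pcompose ramify_poly_pCons poly_pcompose fps_compose_uminus)
  moreover have "convergent_fps (p + - ramify N c)"
    using Np c by (intro convergent_fps_add) (auto intro: convergent_fps_compose_X_power)
  ultimately show ?case using Np(1) by auto
qed

section \<open>Curves with a polynomial parametrization\<close>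

lemma le_total_degree:
  assumes "coeff (coeff g j) i \<noteq> 0"
  shows "i + j \<le> total_degree g"
proof -
  let ?S = "{i + j | i j. coeff (coeff g j) i \<noteq> 0}"
  have "?S \<subseteq> (\<lambda>(i, j). i + j) ` (SIGMA i:(\<Union>j\<le>degree g. {..degree (coeff g j)}). {..degree g})"
  proof clarify
    fix i j assume *: "coeff (coeff g j) i \<noteq> 0"
    then have "coeff g j \<noteq> 0" by auto
    then have "j \<le> degree g" "i \<le> degree (coeff g j)" using * by (auto intro: le_degree)
    then show "i + j \<in> (\<lambda>(i, j). i + j) ` (SIGMA i:(\<Union>j\<le>degree g. {..degree (coeff g j)}). {..degree g})"
      by force
  qed
  then have "finite ?S" by (rule finite_subset) auto
  then show ?thesis unfolding total_degree_def using assms by (intro Max_ge) auto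
qed

lemma total_degree_le:
  assumes "g \<noteq> 0" "\<And>i j. coeff (coeff g j) i \<noteq> 0 \<Longrightarrow> i + j \<le> d"
  shows "total_degree g \<le> d"
proof -
  let ?S = "{i + j | i j. coeff (coeff g j) i \<noteq> 0}"
  have "?S \<subseteq> {..d}" using assms(2) by auto
  then have "finite ?S" by (rule finite_subset) auto
  moreover have "?S \<noteq> {}" using assms(1) by (auto simp: poly_eq_iff)
  ultimately show ?thesis unfolding total_degree_def using assms(2) by (subst Max_le_iff) auto
qed

lemma degree_le_total_degree: "degree g \<le> total_degree g"
proof (cases "g = 0")
  case False
  then have "coeff (coeff g (degree g)) (degree (coeff g (degree g))) \<noteq> 0" by simp
  from le_total_degree[OF this] show ?thesis by simp
qed simp

definition fiber :: "'a::comm_ring_1 poly poly \<Rightarrow> 'a \<Rightarrow> 'a poly" where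
  "fiber g x = map_poly (\<lambda>a. poly a x) g"

lemma coeff_fiber [simp]: "coeff (fiber g x) k = poly (coeff g k) x"
  by (simp add: fiber_def coeff_map_poly)

lemma fiber_0 [simp]: "fiber 0 x = 0"
  by (simp add: poly_eq_iff)

lemma fiber_pCons: "fiber (pCons a g) x = pCons (poly a x) (fiber g x)"
  by (simp add: poly_eq_iff coeff_pCons split: nat.split)

lemma poly_fiber: "poly (fiber g x) y = poly (poly g [:y:]) x"
  by (induction g) (simp_all add: fiber_pCons)

lemma degree_fiber_le: "degree (fiber g x) \<le> degree g"
  by (intro degree_le) (auto simp: coeff_eq_0)

text \<open>The polynomial \<open>g(s ^ e, q s)\<close> in \<open>s\<close>; it is 0 exactly when
  the parametrized curve lies on \<open>g\<close>.\<close>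

definition pullback :: "nat \<Rightarrow> complex poly \<Rightarrow> complex poly poly \<Rightarrow> complex poly" where
  "pullback e q g = (\<Sum>k\<le>degree g. pcompose (coeff g k) (monom 1 e) * q ^ k)"

lemma poly_pullback: "poly (pullback e q g) s = poly (poly g [:poly q s:]) (s ^ e)"
  unfolding poly_fiber[symmetric] poly_eq_sum_le[OF degree_fiber_le]
  by (simp add: pullback_def poly_sum poly_pcompose poly_monom)

text \<open>Inverting \<open>s\<close> turns the behaviour at infinity into continuity of
  \<open>reflect_poly p\<close> at 0, where its value is the leading coefficient. Having the same
  power in both bounds allows values on one circle to be compared with each other.\<close>

lemma poly_growth:
  fixes p :: "complex poly"
  assumes "p \<noteq> 0"
  shows "\<exists>c>0. \<exists>S>0. \<exists>K. \<forall>s. cmod s \<ge> S \<longrightarrow>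
    c * cmod s ^ degree p \<le> cmod (poly p s) \<and> cmod (poly p s) \<le> K * cmod s ^ degree p"
proof -
  define l where "l = cmod (lead_coeff p)"
  have l: "l > 0" using assms by (simp add: l_def)
  have "isCont (\<lambda>w. cmod (poly (reflect_poly p) w)) 0" by (intro continuous_intros)
  then have "(\<lambda>w. cmod (poly (reflect_poly p) w)) \<midarrow>0\<rightarrow> l"
    by (simp add: isCont_def l_def poly_0_coeff_0)
  then have "\<forall>\<^sub>F w in at 0. dist (cmod (poly (reflect_poly p) w)) l < l / 2"
    using l by (intro tendstoD) auto
  then obtain r where r: "r > 0" "\<And>w. w \<noteq> 0 \<Longrightarrow> cmod w < r \<Longrightarrow> dist (cmod (poly (reflect_poly p) w)) l < l / 2"
    by (auto simp: eventually_at)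
  show ?thesis
  proof (rule exI[of _ "l / 2"], rule conjI, rule half_gt_zero[OF l], rule exI[of _ "2 / r"],
      rule conjI, rule divide_pos_pos[OF zero_less_numeral r(1)], rule exI[of _ "2 * l"], intro allI impI)
    fix s assume s: "cmod s \<ge> 2 / r"
    have s0: "s \<noteq> 0" using s r by auto
    have "cmod (inverse s) < r"
    proof -
      have "2 \<le> cmod s * r" using s r by (simp add: field_simps)
      then have "1 < cmod s * r" by simp
      then show ?thesis using s0 by (simp add: norm_divide inverse_eq_divide divide_less_eq mult.commute)
    qed
    then have "dist (cmod (poly (reflect_poly p) (inverse s))) l < l / 2"
      using r s0 by auto
    then have b: "l / 2 \<le> cmod (poly (reflect_poly p) (inverse s))"
      "cmod (poly (reflect_poly p) (inverse s)) \<le> 2 * l"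
      by (auto simp: dist_real_def abs_if split: if_splits)
    have "poly p s = s ^ degree p * poly (reflect_poly p) (inverse s)"
      using s0 by (simp add: poly_reflect_poly_nz power_inverse)
    then have "cmod (poly p s) = cmod s ^ degree p * cmod (poly (reflect_poly p) (inverse s))"
      by (simp add: norm_mult norm_power)
    then show "l / 2 * cmod s ^ degree p \<le> cmod (poly p s) \<and> cmod (poly p s) \<le> 2 * l * cmod s ^ degree p"
      using b mult_left_mono[OF b(1), of "cmod s ^ degree p"] mult_left_mono[OF b(2), of "cmod s ^ degree p"]
      by (simp add: mult.commute)
  qed
qed

lemma poly_bounded_below:
  fixes p :: "complex poly"
  assumes "p \<noteq> 0"
  shows "\<exists>c>0. \<exists>S. \<forall>s. cmod s \<ge> S \<longrightarrow> c \<le> cmod (poly p s)"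
proof -
  obtain c K S where *: "c > 0" "S > 0"
    "\<forall>s. cmod s \<ge> S \<longrightarrow> c * cmod s ^ degree p \<le> cmod (poly p s) \<and> cmod (poly p s) \<le> K * cmod s ^ degree p"
    using poly_growth[OF assms] by blast
  show ?thesis
  proof (rule exI[of _ c], rule conjI, rule *(1), rule exI[of _ "max S 1"], intro allI impI)
    fix s assume s: "cmod s \<ge> max S 1"
    then have "c * 1 \<le> c * cmod s ^ degree p" using *(1) by (intro mult_left_mono one_le_power) auto
    moreover have "c * cmod s ^ degree p \<le> cmod (poly p s)" using *(3) s by auto
    ultimately show "c \<le> cmod (poly p s)" by simp
  qed
qed

text \<open>Both sides have degree below the number of nodes and agree at the nodes. The nodes are
  indexed by a fixed set because they will be conjugates that move with \<open>s\<close>, while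
  their index set does not.\<close>

lemma lagrange_interpolation:
  fixes h :: "'a::field poly"
  assumes U: "finite U" "inj_on x U" and deg: "degree h < card U"
  shows "poly h y = (\<Sum>u\<in>U. poly h (x u) / (\<Prod>v\<in>U - {u}. x u - x v) * (\<Prod>v\<in>U - {u}. y - x v))"
proof -
  define L where "L = (\<Sum>u\<in>U. smult (poly h (x u) / (\<Prod>v\<in>U - {u}. x u - x v)) (\<Prod>v\<in>U - {u}. [:- x v, 1:]))"
  have pL: "poly L y = (\<Sum>u\<in>U. poly h (x u) / (\<Prod>v\<in>U - {u}. x u - x v) * (\<Prod>v\<in>U - {u}. y - x v))" for y
    by (simp add: L_def poly_sum poly_prod)
  have "h = L"
  proof (rule poly_eqI_degree[of "x ` U"])
    fix z assume "z \<in> x ` U"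
    then obtain a where a: "a \<in> U" "z = x a" by blast
    have ne: "(\<Prod>v\<in>U - {a}. x a - x v) \<noteq> 0"
      using U a by (auto simp: inj_on_def)
    have "poly L z = (\<Sum>u\<in>{a}. poly h (x u) / (\<Prod>v\<in>U - {u}. x u - x v) * (\<Prod>v\<in>U - {u}. z - x v))"
      unfolding pL using U a by (intro sum.mono_neutral_right) auto
    also have "\<dots> = poly h z" using a ne by simp
    finally show "poly h z = poly L z" ..
  next
    show "card (x ` U) > degree h" using U deg by (simp add: card_image)
    have "degree L \<le> card U - 1"
      unfolding L_def
    proof (rule degree_sum_le[OF U(1)])
      fix u assume u: "u \<in> U"
      have "degree (\<Prod>v\<in>U - {u}. [:- x v, 1:]) \<le> (\<Sum>v\<in>U - {u}. degree [:- x v, 1:])"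
        using degree_prod_sum_le[of "U - {u}" "\<lambda>v. [:- x v, 1:]"] U by (simp add: o_def)
      also have "\<dots> = card U - 1" using U u by simp
      finally show "degree (smult (poly h (x u) / (\<Prod>v\<in>U - {u}. x u - x v)) (\<Prod>v\<in>U - {u}. [:- x v, 1:])) \<le> card U - 1"
        using degree_smult_le order_trans by blast
    qed
    then show "card (x ` U) > degree L" using U deg by (simp add: card_image)
  qed
  then show ?thesis using pL by metis
qed

text \<open>Otherwise all \<open>e\<close> roots of unity would be roots of
  \<open>X ^ (i mod e) - 1\<close>, which has only \<open>i mod e < e\<close> roots.\<close>

lemma roots_of_unity_dvd:
  assumes "e > 0" "\<And>z::complex. z ^ e = 1 \<Longrightarrow> z ^ i = 1"
  shows "e dvd i"
proof (rule ccontr)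
  assume "\<not> e dvd i"
  then have i: "i mod e > 0" by (simp add: mod_greater_zero_iff_not_dvd)
  have "{z::complex. z ^ e = 1} \<subseteq> {z. z ^ (i mod e) = 1}"
  proof safe
    fix z :: complex assume z: "z ^ e = 1"
    have "z ^ i = (z ^ e) ^ (i div e) * z ^ (i mod e)"
      by (simp flip: power_mult power_add)
    then show "z ^ (i mod e) = 1" using assms(2)[OF z] z by simp
  qed
  then have "card {z::complex. z ^ e = 1} \<le> card {z::complex. z ^ (i mod e) = 1}"
    using i by (intro card_mono finite_roots_unity) auto
  then have "e \<le> i mod e" using i assms(1) by (simp add: card_roots_unity_eq)
  then show False using mod_less_divisor[OF assms(1), of i] by linarith
qed

text \<open>The parametrization \<open>s \<mapsto> (s ^ e, q s)\<close> is not a reparametrization of one in a proper power of \<open>s\<close>.\<close>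

locale primitive_parametrization =
  fixes e :: nat and q :: "complex poly"
  assumes e: "e > 0" and deg_q: "degree q \<le> e"
    and primitive: "\<And>z. z ^ e = 1 \<Longrightarrow> (\<And>s. poly q (z * s) = poly q s) \<Longrightarrow> z = 1"
begin

definition U where "U = {z::complex. z ^ e = 1}"

definition conjugate where "conjugate z = pcompose q [:0, z:]"

lemma U: "finite U" "card U = e" "1 \<in> U"
  using e finite_roots_unity[of e] card_roots_unity_eq[of e] by (auto simp: U_def)

lemma U_nonzero: "z \<in> U \<Longrightarrow> z \<noteq> 0"
  using e by (auto simp: U_def power_0_left)

lemma norm_U: "z \<in> U \<Longrightarrow> cmod z = 1"
proof -
  assume "z \<in> U"
  then have "cmod z ^ e = 1" by (simp add: U_def flip: norm_power)
  then show ?thesis using e power_eq_imp_eq_base[of "cmod z" e 1] by simp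
qed

lemma U_mult: "z \<in> U \<Longrightarrow> w \<in> U \<Longrightarrow> z * w \<in> U"
  by (simp add: U_def power_mult_distrib)

lemma U_divide: "z \<in> U \<Longrightarrow> w \<in> U \<Longrightarrow> z / w \<in> U"
  by (simp add: U_def power_divide)

lemma poly_conjugate [simp]: "poly (conjugate z) s = poly q (z * s)"
  by (simp add: conjugate_def poly_pcompose mult.commute)

lemma inj_on_conjugate: "inj_on conjugate U"
proof (rule inj_onI)
  fix z w assume zw: "z \<in> U" "w \<in> U" "conjugate z = conjugate w"
  have "poly q (z / w * s) = poly q s" for s
    using arg_cong[OF zw(3), of "\<lambda>p. poly p (s / w)"] U_nonzero[OF zw(2)] by simp
  moreover have "(z / w) ^ e = 1" using U_divide[OF zw(1,2)] by (simp add: U_def)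
  ultimately have "z / w = 1" by (rule primitive[rotated])
  then show "z = w" using U_nonzero[OF zw(2)] by simp
qed

text \<open>For \<open>z \<noteq> w\<close> the difference is a nonzero polynomial in
  \<open>s\<close> by primitivity, hence bounded away from 0 for large \<open>s\<close>; finitely
  many pairs share one bound.\<close>

lemma conjugate_separated:
  "\<exists>\<delta>>0. \<exists>S. \<forall>s z w. cmod s \<ge> S \<longrightarrow> z \<in> U \<longrightarrow> w \<in> U \<longrightarrow> z \<noteq> w \<longrightarrow>
    \<delta> \<le> cmod (poly q (z * s) - poly q (w * s))"
proof -
  let ?D = "{(z, w). z \<in> U \<and> w \<in> U \<and> z \<noteq> w}"
  have fin: "finite ?D" by (rule finite_subset[of _ "U \<times> U"]) (use U in auto)
  have "\<forall>zw\<in>?D. \<exists>c>0. \<exists>S. \<forall>s. cmod s \<ge> S \<longrightarrow> c \<le> cmod (poly (conjugate (fst zw) - conjugate (snd zw)) s)"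
  proof
    fix zw assume "zw \<in> ?D"
    then have "fst zw \<in> U" "snd zw \<in> U" "fst zw \<noteq> snd zw" by auto
    then have "conjugate (fst zw) \<noteq> conjugate (snd zw)" by (metis inj_onD[OF inj_on_conjugate])
    then have "conjugate (fst zw) - conjugate (snd zw) \<noteq> 0" by simp
    then show "\<exists>c>0. \<exists>S. \<forall>s. cmod s \<ge> S \<longrightarrow> c \<le> cmod (poly (conjugate (fst zw) - conjugate (snd zw)) s)"
      by (rule poly_bounded_below)
  qed
  from bchoice[OF this] obtain c where c: "\<forall>zw\<in>?D. 0 < c zw \<and>
      (\<exists>S. \<forall>s. cmod s \<ge> S \<longrightarrow> c zw \<le> cmod (poly (conjugate (fst zw) - conjugate (snd zw)) s))" ..
  then have "\<forall>zw\<in>?D. \<exists>S. \<forall>s. cmod s \<ge> S \<longrightarrow> c zw \<le> cmod (poly (conjugate (fst zw) - conjugate (snd zw)) s)"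
    by blast
  from bchoice[OF this] obtain S where S: "\<forall>zw\<in>?D. \<forall>s. cmod s \<ge> S zw \<longrightarrow>
      c zw \<le> cmod (poly (conjugate (fst zw) - conjugate (snd zw)) s)" ..
  \<comment> \<open>The inserted 1, like the 0 below, provides a value when \<open>U = {1}\<close>
    and there are no pairs.\<close>
  have pos: "Min (insert 1 (c ` ?D)) > 0" using fin c by (subst Min_gr_iff) auto
  show ?thesis
  proof (rule exI[of _ "Min (insert 1 (c ` ?D))"], rule conjI, rule pos,
      rule exI[of _ "Max (insert 0 (S ` ?D))"], intro allI impI)
    fix s z w assume s: "cmod s \<ge> Max (insert 0 (S ` ?D))" and zw: "z \<in> U" "w \<in> U" "z \<noteq> w"
    have D: "(z, w) \<in> ?D" using zw by simp
    have "S (z, w) \<le> Max (insert 0 (S ` ?D))" using fin D by (intro Max_ge) auto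
    moreover have "Min (insert 1 (c ` ?D)) \<le> c (z, w)" using fin D by (intro Min_le) auto
    moreover have "cmod s \<ge> S (z, w) \<longrightarrow> c (z, w) \<le> cmod (poly q (z * s) - poly q (w * s))"
      using bspec[OF S D] by simp
    ultimately show "Min (insert 1 (c ` ?D)) \<le> cmod (poly q (z * s) - poly q (w * s))"
      using s by linarith
  qed
qed

text \<open>For each large \<open>s\<close> the polynomial \<open>g(s ^ e, y)\<close> has the
  \<open>e\<close> distinct roots \<open>q(z * s)\<close>, more than its degree allows, so it
  vanishes identically. Thus every nonzero equation of the parametrized curve has degree at least
  \<open>e\<close> in \<open>y\<close>.\<close>

lemma pullback_eq_0_degree:
  assumes "pullback e q g = 0" "degree g < e"
  shows "g = 0"
proof -
  obtain \<delta> S where \<delta>: "\<delta> > 0"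
    "\<And>s z w. cmod s \<ge> S \<Longrightarrow> z \<in> U \<Longrightarrow> w \<in> U \<Longrightarrow> z \<noteq> w \<Longrightarrow> \<delta> \<le> cmod (poly q (z * s) - poly q (w * s))"
    using conjugate_separated by blast
  have fib: "fiber g (s ^ e) = 0" if s: "cmod s \<ge> S" for s
  proof (rule ccontr)
    assume nz: "fiber g (s ^ e) \<noteq> 0"
    have inj: "inj_on (\<lambda>z. poly q (z * s)) U"
      using \<delta>(1) \<delta>(2)[OF s] by (force simp: inj_on_def)
    have "(\<lambda>z. poly q (z * s)) ` U \<subseteq> {y. poly (fiber g (s ^ e)) y = 0}"
    proof safe
      fix z assume "z \<in> U"
      then have "(z * s) ^ e = s ^ e" by (simp add: U_def power_mult_distrib)
      then show "poly (fiber g (s ^ e)) (poly q (z * s)) = 0"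
        using poly_pullback[of e q g "z * s"] assms(1) by (simp add: poly_fiber)
    qed
    then have "card ((\<lambda>z. poly q (z * s)) ` U) \<le> card {y. poly (fiber g (s ^ e)) y = 0}"
      by (intro card_mono poly_roots_finite nz)
    also have "\<dots> \<le> degree (fiber g (s ^ e))" by (rule card_poly_roots_bound[OF nz])
    also have "\<dots> \<le> degree g" by (rule degree_fiber_le)
    finally show False using inj U assms(2) by (simp add: card_image)
  qed
  show "g = 0"
  proof (rule poly_eqI)
    fix k
    have z: "poly (pcompose (coeff g k) (monom 1 e)) s = 0" if "cmod s \<ge> S" for s
      using arg_cong[OF fib[OF that], of "\<lambda>p. coeff p k"] by (simp add: poly_pcompose poly_monom)
    have "pcompose (coeff g k) (monom 1 e) = 0"
    proof (rule ccontr)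
      assume "pcompose (coeff g k) (monom 1 e) \<noteq> 0"
      then obtain c S' where c: "c > 0"
        "\<forall>s. cmod s \<ge> S' \<longrightarrow> c \<le> cmod (poly (pcompose (coeff g k) (monom 1 e)) s)"
        using poly_bounded_below by blast
      define t where "t = complex_of_real (max \<bar>S\<bar> \<bar>S'\<bar>)"
      have "cmod t \<ge> S" "cmod t \<ge> S'" unfolding t_def by auto
      then show False using c(1) c(2) z[of t] by fastforce
    qed
    then show "coeff g k = coeff 0 k"
      using e by (subst (asm) pcompose_eq_0_iff) (auto simp: degree_monom_eq)
  qed
qed

text \<open>The key estimate: \<open>g (s ^ e, y)\<close> is interpolated in \<open>y\<close> at the conjugates \<open>q (z * s)\<close>. Its value at
  \<open>q (z * s)\<close>, divided by the interpolation denominator, is one and the same rational function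
  evaluated at \<open>z * s\<close>, so these quotients are comparable for all \<open>z\<close>. As the conjugates stay apart,
  the term of \<open>z = 1\<close> dominates when \<open>y\<close> is near \<open>q s\<close>.\<close>

lemma curve_stays_away:
  assumes g: "g \<noteq> 0" "degree g < e"
  shows "\<exists>\<delta>>0. \<exists>S. \<forall>s w. cmod s \<ge> S \<longrightarrow> cmod w \<le> \<delta> \<longrightarrow> poly (poly g [:poly q s + w:]) (s ^ e) \<noteq> 0"
proof -
  define H where "H = pullback e q g"
  \<comment> \<open>At \<open>z * s\<close> this is the interpolation denominator of the node
    \<open>q(z * s)\<close>, because \<open>v \<mapsto> v * z\<close> maps \<open>U - {1}\<close>
    onto \<open>U - {z}\<close>.\<close>
  define \<Delta> where "\<Delta> = (\<Prod>z\<in>U - {1}. q - conjugate z)"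
  have H0: "H \<noteq> 0" using pullback_eq_0_degree g by (auto simp: H_def)
  have conjugate_1: "conjugate 1 = q" by (simp add: conjugate_def pcompose_idR)
  have \<Delta>0: "\<Delta> \<noteq> 0"
  proof -
    have "q - conjugate z \<noteq> 0" if "z \<in> U - {1}" for z
      using inj_onD[OF inj_on_conjugate, of z 1] that U conjugate_1 by auto
    then show ?thesis using U by (simp add: \<Delta>_def)
  qed
  obtain c1 K1 S1 where H: "c1 > 0" "S1 > 0"
    "\<forall>s. cmod s \<ge> S1 \<longrightarrow> c1 * cmod s ^ degree H \<le> cmod (poly H s) \<and> cmod (poly H s) \<le> K1 * cmod s ^ degree H"
    using poly_growth[OF H0] by blast
  obtain c2 K2 S2 where \<Delta>: "c2 > 0" "S2 > 0"
    "\<forall>s. cmod s \<ge> S2 \<longrightarrow> c2 * cmod s ^ degree \<Delta> \<le> cmod (poly \<Delta> s) \<and> cmod (poly \<Delta> s) \<le> K2 * cmod s ^ degree \<Delta>"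
    using poly_growth[OF \<Delta>0] by blast
  obtain d S3 where d: "d > 0"
    "\<And>s z w. cmod s \<ge> S3 \<Longrightarrow> z \<in> U \<Longrightarrow> w \<in> U \<Longrightarrow> z \<noteq> w \<Longrightarrow> d \<le> cmod (poly q (z * s) - poly q (w * s))"
    using conjugate_separated by blast
  \<comment> \<open>A bound for \<open>A(z * s)\<close> relative to \<open>A s\<close>, where
    \<open>A\<close> is the quotient of \<open>H\<close> and \<open>\<Delta>\<close> defined below;
    the growth bounds see \<open>cmod s\<close> only. The absolute value and the 1 make
    \<open>K\<close> positive whatever the signs of \<open>K1\<close> and \<open>K2\<close>.\<close>
  define K where "K = \<bar>K1 / c1 * (K2 / c2)\<bar> + 1"
  have K: "K > 0" by (simp add: K_def add_nonneg_pos)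
  \<comment> \<open>The first entry keeps \<open>y\<close> at distance \<open>d / 2\<close> from the
    other conjugates. By the second, the fewer than \<open>e\<close> other terms, each at most
    \<open>K * \<delta> * (2 / d)\<close> times the main term, add up to at most half of it.\<close>
  define \<delta> where "\<delta> = min (d / 2) (d / (4 * K * real e))"
  define A where "A s = poly H s / poly \<Delta> s" for s
  have \<delta>: "\<delta> > 0" "\<delta> \<le> d / 2" using d K e by (auto simp: \<delta>_def)
  have \<delta>': "real e * (K * \<delta> * (2 / d)) \<le> 1 / 2"
  proof -
    have "\<delta> \<le> d / (4 * K * real e)" by (simp add: \<delta>_def)
    then show ?thesis using d K e by (simp add: field_simps)
  qed
  show ?thesis
  proof (rule exI[of _ \<delta>], rule conjI, rule \<delta>(1),
      rule exI[of _ "max 1 (max S1 (max S2 S3))"], intro allI impI)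
    fix s w assume s: "cmod s \<ge> max 1 (max S1 (max S2 S3))" and w: "cmod w \<le> \<delta>"
    have s1: "cmod s \<ge> 1" using s by simp
    define x where "x z = poly q (z * s)" for z
    define y where "y = poly q s + w"
    have y1: "y - x 1 = w" by (simp add: y_def x_def)
    have inj: "inj_on x U"
      using d s unfolding x_def inj_on_def by fastforce
    have sU: "cmod (z * s) = cmod s" if "z \<in> U" for z using norm_U[OF that] by (simp add: norm_mult)
    have \<Delta>U: "poly \<Delta> (z * s) = (\<Prod>v\<in>U - {z}. x z - x v)" if z: "z \<in> U" for z
    proof -
      have "poly \<Delta> (z * s) = (\<Prod>v\<in>U - {1}. x z - x (v * z))"
        by (simp add: \<Delta>_def poly_prod x_def mult.assoc)
      also have "\<dots> = (\<Prod>v\<in>U - {z}. x z - x v)"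
        by (rule prod.reindex_bij_witness[of _ "\<lambda>v. v / z" "\<lambda>v. v * z"])
           (use z U_nonzero[OF z] U_mult U_divide in auto)
      finally show ?thesis .
    qed
    have HU: "poly H (z * s) = poly (fiber g (s ^ e)) (x z)" if z: "z \<in> U" for z
      using z by (simp add: H_def poly_pullback poly_fiber x_def power_mult_distrib U_def)
    have bounds: "poly H s \<noteq> 0" "poly \<Delta> s \<noteq> 0"
    proof -
      have "c1 * cmod s ^ degree H > 0" "c2 * cmod s ^ degree \<Delta> > 0"
        using H \<Delta> s1 by (auto intro!: mult_pos_pos zero_less_power)
      then show "poly H s \<noteq> 0" "poly \<Delta> s \<noteq> 0" using H(3)[rule_format, of s] \<Delta>(3)[rule_format, of s] s by auto
    qed
    have AU: "cmod (A (z * s)) \<le> K * cmod (A s)" if z: "z \<in> U" for z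
    proof -
      define a b where "a = cmod s ^ degree H" and "b = cmod s ^ degree \<Delta>"
      have ab: "a > 0" "b > 0" using s1 by (auto simp: a_def b_def intro!: zero_less_power)
      have Hs: "c1 * a \<le> cmod (poly H s)" "cmod (poly H (z * s)) \<le> K1 * a"
        using H(3)[rule_format, of s] H(3)[rule_format, of "z * s"] sU[OF z] s by (auto simp: a_def)
      have Ds: "cmod (poly \<Delta> s) \<le> K2 * b" "c2 * b \<le> cmod (poly \<Delta> (z * s))"
        using \<Delta>(3)[rule_format, of s] \<Delta>(3)[rule_format, of "z * s"] sU[OF z] s by (auto simp: b_def)
      have K12: "K1 * a \<ge> 0" "K2 * b \<ge> 0" using Hs Ds by (meson norm_ge_zero order_trans)+
      have 1: "cmod (poly H (z * s)) \<le> K1 / c1 * cmod (poly H s)"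
      proof -
        have "K1 * a = K1 / c1 * (c1 * a)" using H(1) by simp
        also have "\<dots> \<le> K1 / c1 * cmod (poly H s)"
          using Hs(1) K12 ab H(1) by (intro mult_left_mono) (auto simp: zero_le_mult_iff)
        finally show ?thesis using Hs(2) by simp
      qed
      have 2: "cmod (poly \<Delta> s) \<le> K2 / c2 * cmod (poly \<Delta> (z * s))"
      proof -
        have "K2 * b = K2 / c2 * (c2 * b)" using \<Delta>(1) by simp
        also have "\<dots> \<le> K2 / c2 * cmod (poly \<Delta> (z * s))"
          using Ds(2) K12 ab \<Delta>(1) by (intro mult_left_mono) (auto simp: zero_le_mult_iff)
        finally show ?thesis using Ds(1) by simp
      qed
      have pos: "cmod (poly \<Delta> s) > 0" "cmod (poly \<Delta> (z * s)) > 0"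
        using bounds(2) less_le_trans[OF mult_pos_pos[OF \<Delta>(1) ab(2)] Ds(2)] by simp_all
      have "cmod (poly H (z * s)) * cmod (poly \<Delta> s)
          \<le> (K1 / c1 * cmod (poly H s)) * (K2 / c2 * cmod (poly \<Delta> (z * s)))"
        using 1 2 by (intro mult_mono) (auto intro: order_trans[OF norm_ge_zero])
      also have "\<dots> = (K1 / c1 * (K2 / c2)) * (cmod (poly H s) * cmod (poly \<Delta> (z * s)))"
        by (simp add: mult_ac)
      also have "\<dots> \<le> K * (cmod (poly H s) * cmod (poly \<Delta> (z * s)))"
        unfolding K_def using abs_ge_self[of "K1 / c1 * (K2 / c2)"] by (intro mult_right_mono) (linarith, simp)
      finally have "cmod (poly H (z * s)) / cmod (poly \<Delta> (z * s)) \<le> K * (cmod (poly H s) / cmod (poly \<Delta> s))"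
        using pos by (simp add: field_simps)
      then show ?thesis by (simp add: A_def norm_divide)
    qed
    have yv: "cmod (y - x v) \<ge> d / 2" if v: "v \<in> U - {1}" for v
    proof -
      have "d \<le> cmod (x 1 - x v)" using d(2)[of s 1 v] s v U by (auto simp: x_def)
      also have "\<dots> \<le> cmod (y - x v) + cmod w"
        using norm_triangle_ineq4[of "y - x v" w] by (simp add: y_def x_def)
      finally show ?thesis using w \<delta> by linarith
    qed
    define \<Psi> where "\<Psi> = (\<Prod>v\<in>U - {1}. y - x v)"
    have yv0: "y - x v \<noteq> 0" if "v \<in> U - {1}" for v using yv[OF that] d(1) by auto
    then have \<Psi>0: "\<Psi> \<noteq> 0" unfolding \<Psi>_def using U by (subst prod_zero_iff) blast+
    have A0: "A s \<noteq> 0" using bounds by (simp add: A_def)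
    have "poly (fiber g (s ^ e)) y
        = (\<Sum>u\<in>U. poly (fiber g (s ^ e)) (x u) / (\<Prod>v\<in>U - {u}. x u - x v) * (\<Prod>v\<in>U - {u}. y - x v))"
      using U inj g degree_fiber_le[of g "s ^ e"] by (intro lagrange_interpolation) auto
    also have "\<dots> = (\<Sum>u\<in>U. A (u * s) * (\<Prod>v\<in>U - {u}. y - x v))"
      by (intro sum.cong refl) (simp add: HU \<Delta>U A_def)
    also have "\<dots> = A s * \<Psi> + (\<Sum>u\<in>U - {1}. A (u * s) * (\<Prod>v\<in>U - {u}. y - x v))"
      using U by (subst sum.remove[of _ 1]) (auto simp: \<Psi>_def)
    finally have eq: "poly (fiber g (s ^ e)) y
        = A s * \<Psi> + (\<Sum>u\<in>U - {1}. A (u * s) * (\<Prod>v\<in>U - {u}. y - x v))" .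
    have "cmod (\<Sum>u\<in>U - {1}. A (u * s) * (\<Prod>v\<in>U - {u}. y - x v))
        \<le> (\<Sum>u\<in>U - {1}. K * \<delta> * (2 / d) * cmod (A s * \<Psi>))"
    proof (intro order_trans[OF norm_sum] sum_mono)
      fix u assume u: "u \<in> U - {1}"
      \<comment> \<open>The product for \<open>u\<close> arises from \<open>\<Psi>\<close> by
        exchanging the factor \<open>y - x u\<close> for \<open>y - x 1 = w\<close>, which is
        small.\<close>
      have "\<Psi> = (y - x u) * (\<Prod>v\<in>U - {1} - {u}. y - x v)"
        unfolding \<Psi>_def using U u by (subst prod.remove[of _ u]) auto
      moreover have "(\<Prod>v\<in>U - {u}. y - x v) = w * (\<Prod>v\<in>U - {u} - {1}. y - x v)"
        using U u y1 by (subst prod.remove[of _ 1]) auto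
      moreover have "U - {u} - {1} = U - {1} - {u}" by auto
      ultimately have "(\<Prod>v\<in>U - {u}. y - x v) = w / (y - x u) * \<Psi>"
        using yv0[OF u] by auto
      then have "cmod (A (u * s) * (\<Prod>v\<in>U - {u}. y - x v)) = cmod (A (u * s)) * (cmod w / cmod (y - x u)) * cmod \<Psi>"
        by (simp add: norm_mult norm_divide)
      also have "\<dots> \<le> (K * cmod (A s)) * (\<delta> / (d / 2)) * cmod \<Psi>"
        using AU[of u] u yv[OF u] w d K \<delta> by (intro mult_mono frac_le) auto
      also have "\<dots> = K * \<delta> * (2 / d) * cmod (A s * \<Psi>)" by (simp add: norm_mult)
      finally show "cmod (A (u * s) * (\<Prod>v\<in>U - {u}. y - x v)) \<le> K * \<delta> * (2 / d) * cmod (A s * \<Psi>)" .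
    qed
    also have "\<dots> = real (card (U - {1})) * (K * \<delta> * (2 / d)) * cmod (A s * \<Psi>)" by simp
    also have "\<dots> \<le> real e * (K * \<delta> * (2 / d)) * cmod (A s * \<Psi>)"
      using U K \<delta> d by (intro mult_right_mono) auto
    also have "\<dots> \<le> 1 / 2 * cmod (A s * \<Psi>)" using \<delta>' by (intro mult_right_mono) auto
    also have "\<dots> < cmod (A s * \<Psi>)" using A0 \<Psi>0 by simp
    finally have less: "cmod (\<Sum>u\<in>U - {1}. A (u * s) * (\<Prod>v\<in>U - {u}. y - x v)) < cmod (A s * \<Psi>)" .
    have "poly (fiber g (s ^ e)) y \<noteq> 0"
    proof
      assume "poly (fiber g (s ^ e)) y = 0"
      then have "(\<Sum>u\<in>U - {1}. A (u * s) * (\<Prod>v\<in>U - {u}. y - x v)) = - (A s * \<Psi>)"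
        unfolding eq add_eq_0_iff .
      with less show False by simp
    qed
    then show "poly (poly g [:poly q s + w:]) (s ^ e) \<noteq> 0" by (simp add: poly_fiber y_def)
  qed
qed

end

text \<open>Undoes the substitution \<open>x := s ^ e\<close> on polynomials in
  \<open>s ^ e\<close>.\<close>

definition contract :: "nat \<Rightarrow> complex poly \<Rightarrow> complex poly" where
  "contract e a = Poly (map (\<lambda>i. coeff a (e * i)) [0..<Suc (degree a)])"

lemma coeff_mult_eq_0: "e > 0 \<Longrightarrow> i > degree a \<Longrightarrow> coeff a (e * i) = 0"
proof (rule coeff_eq_0)
  assume "e > 0" "i > degree a"
  then show "degree a < e * i" using mult_le_mono1[of 1 e i] by linarith
qed

lemma coeff_contract: "e > 0 \<Longrightarrow> coeff (contract e a) i = coeff a (e * i)"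
  by (auto simp: contract_def nth_default_def coeff_mult_eq_0 simp del: upt_Suc)

lemma poly_contract:
  assumes "e > 0" "\<And>i. coeff a i \<noteq> 0 \<Longrightarrow> e dvd i"
  shows "poly (contract e a) (s ^ e) = poly a s"
proof -
  have "pcompose (contract e a) (monom 1 e) = a"
  proof (rule poly_eqI)
    fix n
    have deg: "degree (contract e a) \<le> degree a"
      using assms(1) by (intro degree_le)
        (auto simp: coeff_contract coeff_mult_eq_0)
    have "pcompose (contract e a) (monom 1 e) = (\<Sum>i\<le>degree a. smult (coeff a (e * i)) (monom 1 (e * i)))"
      unfolding pcompose_altdef
      by (subst poly_eq_sum_le[of _ "degree a"])
         (use deg assms(1) in \<open>auto simp: coeff_map_poly coeff_contract monom_power
            coeff_mult_eq_0 intro!: degree_le\<close>)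
    then have *: "coeff (pcompose (contract e a) (monom 1 e)) n
        = (\<Sum>i\<le>degree a. if e * i = n then coeff a n else 0)"
      by (auto simp: coeff_sum intro!: sum.cong)
    show "coeff (pcompose (contract e a) (monom 1 e)) n = coeff a n"
    proof (cases "coeff a n = 0")
      case True
      then show ?thesis unfolding * by (simp cong: if_cong)
    next
      case False
      then obtain k where k: "n = e * k" using assms(2)[of n] by auto
      have "k \<le> n" using k assms(1) by simp
      also have "n \<le> degree a" using False by (rule le_degree)
      finally have "k \<le> degree a" .
      moreover have "(e * i = n) = (i = k)" for i using k assms(1) by simp
      ultimately show ?thesis unfolding * by simp
    qed
  qed
  then show ?thesis by (metis mult_1 poly_monom poly_pcompose)
qed

section \<open>The implicit equation of the parametrized curve\<close>

context primitive_parametrization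
begin

text \<open>Invariance under \<open>s \<mapsto> z * s\<close> makes \<open>norm_poly\<close> a polynomial in \<open>s ^ e\<close> and \<open>y\<close>; replacing \<open>s ^ e\<close> by \<open>x\<close>
  gives \<open>implicit_poly\<close> below.\<close>

definition norm_poly :: "complex poly poly" where
  "norm_poly = (\<Prod>z\<in>U. [:- conjugate z, 1:])"

lemma poly_norm_poly: "poly (poly norm_poly [:y:]) s = (\<Prod>z\<in>U. y - poly q (z * s))"
  by (simp add: norm_poly_def poly_prod)

lemma degree_norm_poly: "degree norm_poly = e"
  unfolding norm_poly_def using U by (subst degree_prod_eq_sum_degree) auto

lemma lead_coeff_norm_poly: "lead_coeff norm_poly = 1"
  unfolding norm_poly_def lead_coeff_prod by simp

text \<open>Under \<open>s := z * s\<close> the coefficient of \<open>s ^ i\<close> is multiplied by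
  \<open>z ^ i\<close>, so by invariance it survives only if \<open>z ^ i = 1\<close> for every
  \<open>e\<close>-th root of unity.\<close>

lemma coeff_norm_poly_dvd:
  assumes "coeff (coeff norm_poly k) i \<noteq> 0"
  shows "e dvd i"
proof (rule roots_of_unity_dvd[OF e])
  fix z :: complex assume "z ^ e = 1"
  then have z: "z \<in> U" by (simp add: U_def)
  have "fiber norm_poly (z * s) = fiber norm_poly s" for s
  proof -
    have "(\<Prod>v\<in>U. y - poly q (v * (z * s))) = (\<Prod>v\<in>U. y - poly q (v * s))" for y
      by (rule prod.reindex_bij_witness[of _ "\<lambda>v. v / z" "\<lambda>v. v * z"])
         (use z U_nonzero[OF z] U_mult U_divide in \<open>auto simp: mult.assoc\<close>)
    then show ?thesis by (simp add: poly_fiber poly_norm_poly fun_eq_iff flip: poly_eq_poly_eq_iff)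
  qed
  from arg_cong[OF this, of "\<lambda>p. coeff p k"]
  have "poly (pcompose (coeff norm_poly k) [:0, z:]) s = poly (coeff norm_poly k) s" for s
    by (simp add: poly_pcompose mult.commute)
  then have "pcompose (coeff norm_poly k) [:0, z:] = coeff norm_poly k"
    unfolding poly_eq_poly_eq_iff[symmetric] fun_eq_iff by blast
  moreover have "[:0, z:] = monom z (Suc 0)" by (simp add: monom_Suc monom_0)
  ultimately have "coeff (coeff norm_poly k) i = z ^ i * coeff (coeff norm_poly k) i"
    using coeff_pcompose_monom_linear[of "coeff norm_poly k" z i] by simp
  then show "z ^ i = 1" using assms by simp
qed

text \<open>Give \<open>s\<close> weight 1 and \<open>y\<close> weight \<open>e\<close>. Each of the
  \<open>e\<close> factors \<open>y - q(z * s)\<close> has weight at most \<open>e\<close> because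
  \<open>degree q \<le> e\<close>. Replacing \<open>s ^ e\<close> by \<open>x\<close> divides the
  weights by \<open>e\<close>, so this bounds the total degree of the implicit equation.\<close>

lemma norm_poly_weight:
  assumes "coeff (coeff norm_poly k) i \<noteq> 0"
  shows "i + e * k \<le> e * e"
proof -
  \<comment> \<open>Stated for every finite set of scalars, so that the induction can add one factor
    at a time.\<close>
  have "finite A \<Longrightarrow> coeff (coeff (\<Prod>z\<in>A. [:- conjugate z, 1:]) k) i \<noteq> 0 \<Longrightarrow> i + e * k \<le> e * card A" for A
  proof (induction A arbitrary: i k rule: finite_induct)
    case empty
    then show ?case by (cases k; cases i) auto
  next
    case (insert a A)
    define P where "P = (\<Prod>z\<in>A. [:- conjugate z, 1:])"
    have "(\<Prod>z\<in>insert a A. [:- conjugate z, 1:]) = smult (- conjugate a) P + pCons 0 P"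
      using insert.hyps by (simp add: P_def)
    then have "coeff (- conjugate a * coeff P k) i \<noteq> 0 \<or> coeff (coeff (pCons 0 P) k) i \<noteq> 0"
      using insert.prems by auto
    then show ?case
    proof
      assume "coeff (- conjugate a * coeff P k) i \<noteq> 0"
      then have "(\<Sum>j\<le>i. coeff (- conjugate a) j * coeff (coeff P k) (i - j)) \<noteq> 0"
        unfolding coeff_mult .
      then obtain j where j: "j \<le> i" "coeff (conjugate a) j \<noteq> 0" "coeff (coeff P k) (i - j) \<noteq> 0"
        by (auto elim!: sum.not_neutral_contains_not_neutral)
      have "j \<le> degree (conjugate a)" using j(2) by (rule le_degree)
      also have "\<dots> \<le> degree q * degree [:0, a:]" unfolding conjugate_def by (rule degree_pcompose_le)
      also have "\<dots> \<le> e * 1" using deg_q by (intro mult_mono) auto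
      finally have "j \<le> e" by simp
      moreover have "(i - j) + e * k \<le> e * card A"
        using insert.IH j(3) unfolding P_def by blast
      ultimately show ?thesis using insert.hyps j(1) by simp
    next
      assume "coeff (coeff (pCons 0 P) k) i \<noteq> 0"
      then obtain k' where "k = Suc k'" "coeff (coeff P k') i \<noteq> 0"
        by (cases k) auto
      moreover from this have "i + e * k' \<le> e * card A"
        using insert.IH unfolding P_def by blast
      ultimately show ?thesis using insert.hyps by simp
    qed
  qed
  from this[of U] show ?thesis using U assms unfolding norm_poly_def by simp
qed

definition implicit_poly :: "complex poly poly" where
  "implicit_poly = map_poly (contract e) norm_poly"

lemma coeff_implicit_poly: "coeff (coeff implicit_poly k) i = coeff (coeff norm_poly k) (e * i)"
proof -
  have "contract e 0 = 0" using e by (simp add: poly_eq_iff coeff_contract)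
  then show ?thesis using e by (simp add: implicit_poly_def coeff_map_poly coeff_contract)
qed

lemma coeff_implicit_poly': "coeff implicit_poly k = contract e (coeff norm_poly k)"
  using e by (simp add: poly_eq_iff coeff_implicit_poly coeff_contract)

lemma poly_implicit_poly: "poly (poly implicit_poly [:y:]) (s ^ e) = (\<Prod>z\<in>U. y - poly q (z * s))"
proof -
  have "fiber implicit_poly (s ^ e) = fiber norm_poly s"
    using poly_contract[OF e coeff_norm_poly_dvd] by (simp add: poly_eq_iff coeff_implicit_poly')
  then show ?thesis by (metis poly_fiber poly_norm_poly)
qed

lemma implicit_poly_on_curve: "poly (poly implicit_poly [:poly q s:]) (s ^ e) = 0"
  using U by (auto simp: poly_implicit_poly intro!: bexI[of _ 1])

lemma degree_implicit_poly: "degree implicit_poly = e"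
  and lead_coeff_implicit_poly: "lead_coeff implicit_poly = 1"
proof -
  have "coeff (coeff implicit_poly e) i = coeff (1::complex poly) i" for i
    using lead_coeff_norm_poly e unfolding degree_norm_poly by (simp add: coeff_implicit_poly coeff_1)
  then have 1: "coeff implicit_poly e = 1" by (rule poly_eqI)
  show 2: "degree implicit_poly = e"
  proof (rule antisym)
    show "degree implicit_poly \<le> e"
      using degree_norm_poly by (intro degree_le) (auto simp: poly_eq_iff coeff_implicit_poly coeff_eq_0)
    show "e \<le> degree implicit_poly" using 1 by (intro le_degree) simp
  qed
  show "lead_coeff implicit_poly = 1" using 1 2 by simp
qed

lemma total_degree_implicit_poly: "total_degree implicit_poly \<le> e"
proof (rule total_degree_le)
  show "implicit_poly \<noteq> 0" using lead_coeff_implicit_poly by auto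
  fix i j assume "coeff (coeff implicit_poly j) i \<noteq> 0"
  then have "e * i + e * j \<le> e * e" by (intro norm_poly_weight) (simp add: coeff_implicit_poly)
  then have "e * (i + j) \<le> e * e" by (simp add: algebra_simps)
  then show "i + j \<le> e" using e by simp
qed

text \<open>In a factorization, one factor vanishes on the parametrized curve, because the pullbacks
  live in an integral domain. That factor already has degree at least \<open>e\<close> in
  \<open>y\<close>, so the other is a polynomial in \<open>x\<close> alone; it divides the leading
  coefficient 1 and is a unit.\<close>

lemma irreducible_implicit_poly: "irreducible implicit_poly"
proof (rule irreducibleI)
  show nz: "implicit_poly \<noteq> 0" using lead_coeff_implicit_poly by auto
  show "\<not> implicit_poly dvd 1"
    using degree_implicit_poly e by (auto simp: is_unit_poly_iff)
  have unit: "b dvd 1" if ab: "implicit_poly = a * b" and a: "pullback e q a = 0" for a b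
  proof -
    have ab0: "a \<noteq> 0" "b \<noteq> 0" using ab nz by auto
    have "degree a \<ge> e" using pullback_eq_0_degree[OF a] ab0 by force
    then have "degree b = 0" using degree_implicit_poly ab ab0 by (simp add: degree_mult_eq)
    then obtain c where c: "b = [:c:]" by (rule degree_eq_zeroE)
    have "lead_coeff a * c = 1" using lead_coeff_implicit_poly unfolding ab lead_coeff_mult by (simp add: c)
    then have "c dvd 1" by (metis dvd_triv_right)
    then show ?thesis by (simp add: c is_unit_const_poly_iff)
  qed
  fix a b assume ab: "implicit_poly = a * b"
  have "poly (pullback e q a * pullback e q b) s = 0" for s
    using implicit_poly_on_curve[of s] by (simp add: ab poly_pullback)
  then have "pullback e q a * pullback e q b = 0" by (simp add: poly_eq_poly_eq_iff[symmetric] fun_eq_iff)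
  then show "a dvd 1 \<or> b dvd 1"
    using unit[OF ab] unit[of b a] ab by (auto simp: mult.commute)
qed

end

section \<open>Puiseux solutions and their conjugates\<close>

definition supp :: "complex fps \<Rightarrow> nat set" where
  "supp p = {i. p $ i \<noteq> 0}"

text \<open>The order of \<open>z\<close> divides every element of \<open>A\<close>, hence the gcd;
  the element \<open>N\<close> ensures that this order is positive. The argument covers infinite
  \<open>A\<close>, such as the support of a series.\<close>

lemma power_Gcd_eq_1:
  fixes z :: "'a::monoid_mult" and A :: "nat set"
  assumes "N \<in> A" "N > 0" and A: "\<And>k. k \<in> A \<Longrightarrow> z ^ k = 1"
  shows "z ^ Gcd A = 1"
proof -
  define m where "m = (LEAST k. k > 0 \<and> z ^ k = 1)"
  have m: "m > 0" "z ^ m = 1"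
    using LeastI[of "\<lambda>k. k > 0 \<and> z ^ k = 1" N] assms by (auto simp: m_def)
  have "m dvd k" if "k \<in> A" for k
  proof (rule ccontr)
    assume "\<not> m dvd k"
    then have "k mod m > 0" by (simp add: mod_greater_zero_iff_not_dvd)
    moreover have "z ^ k = (z ^ m) ^ (k div m) * z ^ (k mod m)"
      by (simp flip: power_mult power_add)
    then have "z ^ (k mod m) = 1" using m A[OF that] by simp
    ultimately have "m \<le> k mod m" unfolding m_def by (intro Least_le) simp
    then show False using mod_less_divisor[OF m(1), of k] by linarith
  qed
  then have "m dvd Gcd A" by (rule Gcd_greatest)
  then show ?thesis using m by (auto elim!: dvdE simp: power_mult)
qed

lemma Gcd_image_mult: "Gcd ((*) c ` A) = c * Gcd A" for c :: nat
  by (simp add: Gcd_mult)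

lemma of_nat_div_Ints_iff:
  assumes "N > 0"
  shows "(of_nat K * (of_nat i / of_nat N) \<in> (\<int> :: rat set)) \<longleftrightarrow> N dvd K * i"
  using of_int_div_of_int_in_Ints_iff[of "int (K * i)" "int N", where ?'a = rat] assms
  by (simp flip: int_dvd_int_iff)

text \<open>The least common denominator of the exponents \<open>i / N\<close> is \<open>N\<close>
  divided by the gcd of \<open>N\<close> and the support. Coprimality is the form in which the
  ramification index enters the count of conjugates.\<close>

lemma ramification_index_eq_iff:
  assumes "N > 0"
  shows "ramification_index (N, p) = N \<longleftrightarrow> Gcd (insert N (supp p)) = 1"
proof
  define g where "g = Gcd (insert N (supp p))"
  have g: "g dvd N" "\<And>i. i \<in> supp p \<Longrightarrow> g dvd i" unfolding g_def by (blast intro: Gcd_dvd)+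
  have g0: "g > 0" using g(1) assms by (auto intro!: Nat.gr0I)
  {
    assume *: "ramification_index (N, p) = N"
    have "N div g > 0" using g(1) g0 assms by (auto elim!: dvdE)
    moreover have "N dvd N div g * i" if "p $ i \<noteq> 0" for i
      using g(1) g(2)[of i] that g0 by (auto simp: supp_def elim!: dvdE)
    ultimately have "ramification_index (N, p) \<le> N div g"
      using assms unfolding ramification_index_def prod.case
      by (intro Least_le) (simp add: of_nat_div_Ints_iff del: times_divide_eq_right)
    then have "N \<le> N div g" using * by simp
    then show "Gcd (insert N (supp p)) = 1"
      using assms g0 unfolding g_def[symmetric] by (metis div_less_dividend leD less_one linorder_neqE_nat not_gr0)
  }
  assume 1: "Gcd (insert N (supp p)) = 1"
  show "ramification_index (N, p) = N"
    unfolding ramification_index_def prod.case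
  proof (rule Least_equality)
    show "0 < N \<and> (\<forall>i. p $ i \<noteq> 0 \<longrightarrow> of_nat N * (of_nat i / of_nat N) \<in> (\<int> :: rat set))"
      using assms by (simp add: of_nat_div_Ints_iff del: times_divide_eq_right)
    fix K :: nat assume K: "0 < K \<and> (\<forall>i. p $ i \<noteq> 0 \<longrightarrow> of_nat K * (of_nat i / of_nat N) \<in> (\<int> :: rat set))"
    then have "N dvd K * i" if "i \<in> insert N (supp p)" for i
      using that assms by (auto simp: of_nat_div_Ints_iff supp_def simp del: times_divide_eq_right)
    then have "N dvd Gcd ((*) K ` insert N (supp p))" by (intro Gcd_greatest) auto
    also have "\<dots> = K" using 1 unfolding Gcd_image_mult by simp
    finally show "N \<le> K" using K by (intro dvd_imp_le) auto
  qed
qed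

section \<open>Conjugation as the substitution \<open>X := c * X\<close>\<close>

definition twist :: "complex \<Rightarrow> complex fps \<Rightarrow> complex fps" where
  "twist c p = Abs_fps (\<lambda>i. p $ i * c ^ i)"

lemma nth_twist [simp]: "twist c p $ i = p $ i * c ^ i"
  by (simp add: twist_def)

lemma twist_eq_compose: "twist c p = p oo (fps_const c * fps_X)"
  by (simp add: fps_eq_iff)

lemma conjugates_eq: "conjugates (N, p) = (\<lambda>c. (N, twist c p)) ` {c. c ^ N = 1}"
  by (auto simp: conjugates_def twist_def)

lemma twist_add: "twist c (p + q) = twist c p + twist c q"
  by (simp add: fps_eq_iff distrib_right)

lemma twist_mult: "twist c (p * q) = twist c p * twist c q"
  unfolding twist_eq_compose by (rule fps_compose_mult_distrib) simp

lemma twist_0 [simp]: "twist c 0 = 0"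
  by (simp add: fps_eq_iff)

lemma twist_1 [simp]: "twist 1 p = p"
  by (simp add: fps_eq_iff)

lemma twist_twist: "twist c (twist d p) = twist (c * d) p"
  by (simp add: fps_eq_iff power_mult_distrib mult_ac)

lemma supp_twist: "c \<noteq> 0 \<Longrightarrow> supp (twist c p) = supp p"
  by (simp add: supp_def)

lemma twist_ramify: "c ^ N = 1 \<Longrightarrow> N > 0 \<Longrightarrow> twist c (ramify N a) = ramify N a"
  by (auto simp: fps_eq_iff fps_nth_compose_X_power power_mult elim!: dvdE)

text \<open>For \<open>c ^ N = 1\<close> the substitution fixes \<open>X ^ N\<close>, hence the
  coefficients of the ramified polynomial, and so permutes its roots like a Galois
  automorphism.\<close>

lemma poly_ramify_poly_twist:
  assumes "c ^ N = 1" "N > 0"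
  shows "poly (ramify_poly N P) (twist c p) = twist c (poly (ramify_poly N P) p)"
  by (induction P) (simp_all add: ramify_poly_pCons twist_add twist_mult twist_ramify assms)

text \<open>If the twists by \<open>c\<close> and \<open>d\<close> agree, then
  \<open>(c / d) ^ k = 1\<close> for \<open>k = N\<close> and for every \<open>k\<close> in the
  support, hence for their gcd 1.\<close>

lemma inj_on_twist:
  assumes "N > 0" "Gcd (insert N (supp p)) = 1"
  shows "inj_on (\<lambda>c. twist c p) {c. c ^ N = 1}"
proof (rule inj_onI, clarify)
  fix c d assume c: "c ^ N = 1" and d: "d ^ N = 1" and eq: "twist c p = twist d p"
  have d0: "d \<noteq> 0" using d assms by (auto simp: power_0_left)
  have "(c / d) ^ k = 1" if "k \<in> insert N (supp p)" for k
  proof (cases "k = N")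
    case True
    then show ?thesis using c d by (simp add: power_divide)
  next
    case False
    then have "p $ k \<noteq> 0" using that by (simp add: supp_def)
    moreover have "p $ k * c ^ k = p $ k * d ^ k" using eq by (metis nth_twist)
    ultimately show ?thesis using d0 by (simp add: power_divide)
  qed
  then have "(c / d) ^ Gcd (insert N (supp p)) = 1"
    using assms(1) by (intro power_Gcd_eq_1[of N]) auto
  then show "c = d" using assms(2) d0 by simp
qed

lemma conjugates_twist:
  assumes "c ^ N = 1" "N > 0"
  shows "conjugates (N, twist c p) = conjugates (N, p)"
proof -
  have c0: "c \<noteq> 0" using assms by (auto simp: power_0_left)
  have "{d::complex. d ^ N = 1} = (\<lambda>d. d * c) ` {d. d ^ N = 1}"
  proof (intro set_eqI iffI)
    fix d :: complex assume "d \<in> {d. d ^ N = 1}"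
    then have "d = d / c * c" "(d / c) ^ N = 1" using c0 assms by (auto simp: power_divide)
    then show "d \<in> (\<lambda>d. d * c) ` {d. d ^ N = 1}" by blast
  qed (use assms in \<open>auto simp: power_mult_distrib\<close>)
  then have "conjugates (N, p) = (\<lambda>c. (N, twist c p)) ` (\<lambda>d. d * c) ` {d. d ^ N = 1}"
    by (simp add: conjugates_eq)
  then show ?thesis by (simp add: conjugates_eq image_image twist_twist)
qed

lemma puiseux_degree_twist:
  assumes "c \<noteq> 0"
  shows "puiseux_degree (N, twist c p) = puiseux_degree (N, p)"
  using assms by (simp add: puiseux_degree_def)

lemma self_in_conjugates: "(N, p) \<in> conjugates (N, p)"
  unfolding conjugates_eq by (rule image_eqI[of _ _ 1]) auto

lemma branch_degree_conjugates:
  assumes "\<phi> \<in> conjugates (N, p)" "N > 0"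
  shows "puiseux_degree \<phi> = puiseux_degree (N, p)" 
    and "branch_degree (conjugates (N, p)) = puiseux_degree (N, p)"
proof -
  have *: "puiseux_degree \<psi> = puiseux_degree (N, p)" if "\<psi> \<in> conjugates (N, p)" for \<psi>
  proof -
    obtain c where "\<psi> = (N, twist c p)" "c ^ N = 1" using \<open>\<psi> \<in> _\<close> by (auto simp: conjugates_eq)
    moreover from this have "c \<noteq> 0" using assms(2) by (auto simp: power_0_left)
    ultimately show ?thesis by (simp add: puiseux_degree_twist)
  qed
  then show "puiseux_degree \<phi> = puiseux_degree (N, p)" using assms by simp
  have "puiseux_degree ` conjugates (N, p) = (\<lambda>_. puiseux_degree (N, p)) ` conjugates (N, p)"
    by (intro image_cong refl *)
  also have "\<dots> = {puiseux_degree (N, p)}" using self_in_conjugates[of N p] by blast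
  finally show "branch_degree (conjugates (N, p)) = puiseux_degree (N, p)"
    by (simp add: branch_degree_def)
qed

text \<open>The polynomial \<open>F(1, Y, X)\<close> in \<open>Y\<close>.\<close>

definition infinity_poly :: "complex poly poly \<Rightarrow> complex fps poly" where
  "infinity_poly f = (\<Sum>k\<le>total_degree f. \<Sum>j\<le>k.
     monom (fps_X ^ (total_degree f - k) * fps_const (coeff (coeff f j) (k - j))) j)"

section \<open>The equation of the curve at infinity\<close>

lemma ramify_poly_sum: "ramify_poly N (sum g A) = (\<Sum>a\<in>A. ramify_poly N (g a))"
  by (induction A rule: infinite_finite_induct) (simp_all add: ramify_poly_add)

lemma ramify_poly_monom: "ramify_poly N (monom a j) = monom (ramify N a) j"
  by (auto simp: poly_eq_iff)

lemma homogenization_eq_poly: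
  assumes "N > 0"
  shows "homogenization fps_const f 1 p (fps_X ^ N) = poly (ramify_poly N (infinity_poly f)) p"
  using assms unfolding homogenization_def homog_part_def infinity_poly_def
  by (simp add: ramify_poly_sum ramify_poly_monom poly_sum poly_monom ramify_mult ramify_X_power
      sum_distrib_left mult_ac power_mult)

lemma infinity_point_0_1_iff: "infinity_point f 0 1 \<longleftrightarrow> coeff (coeff f (total_degree f)) 0 = 0"
proof -
  let ?d = "total_degree f"
  have "homog_part id f ?d 0 1 = (\<Sum>j\<in>{?d}. coeff (coeff f j) (?d - j) * 0 ^ (?d - j))"
    unfolding homog_part_def by (intro sum.mono_neutral_cong_right) auto
  then show ?thesis by (simp add: infinity_point_def)
qed

text \<open>Only the top homogeneous part contributes to this power of \<open>Y\<close>, so the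
  coefficient is a constant. It is nonzero if \<open>(0:1:0)\<close> is not an infinity point, and
  then a scalar makes the polynomial monic, as Hensel factorization requires.\<close>

lemma coeff_infinity_poly_total_degree:
  "coeff (infinity_poly f) (total_degree f) = fps_const (coeff (coeff f (total_degree f)) 0)"
proof -
  let ?d = "total_degree f"
  let ?a = "\<lambda>k j. fps_X ^ (?d - k) * fps_const (coeff (coeff f j) (k - j))"
  have "coeff (infinity_poly f) ?d = (\<Sum>k\<le>?d. \<Sum>j\<le>k. if j = ?d then ?a k j else 0)"
    by (simp add: infinity_poly_def coeff_sum)
  also have "\<dots> = (\<Sum>k\<in>{?d}. \<Sum>j\<le>k. if j = ?d then ?a k j else 0)"
    by (rule sum.mono_neutral_right) (auto intro!: sum.neutral)
  finally show ?thesis by simp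
qed

lemma degree_infinity_poly_le: "degree (infinity_poly f) \<le> total_degree f"
  unfolding infinity_poly_def
  by (intro degree_sum_le order_trans[OF degree_monom_le]) auto

lemma convergent_infinity_poly: "convergent_poly (infinity_poly f)"
  unfolding convergent_poly_def infinity_poly_def
  by (auto simp: coeff_sum intro!: convergent_fps_sum convergent_fps_mult)

lemma degree_infinity_poly:
  assumes "\<not> infinity_point f 0 1"
  shows "degree (infinity_poly f) = total_degree f"
  using assms degree_infinity_poly_le[of f]
  by (intro antisym le_degree) (simp_all add: coeff_infinity_poly_total_degree infinity_point_0_1_iff)

section \<open>Existence, reduction and uniqueness of Puiseux solutions\<close>

lemma convergent_puiseux_solution_exists:
  assumes "\<not> infinity_point f 0 1" "total_degree f > 0"
  obtains N p where "N > 0" "convergent_fps p" "homogenization fps_const f 1 p (fps_X ^ N) = 0"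
proof -
  define c where "c = coeff (coeff f (total_degree f)) 0"
  have c: "c \<noteq> 0" using assms by (simp add: infinity_point_0_1_iff c_def)
  define P where "P = smult (fps_const (1 / c)) (infinity_poly f)"
  have "convergent_poly P"
    using convergent_infinity_poly[of f] unfolding P_def convergent_poly_def
    by (auto intro: convergent_fps_mult)
  moreover have "degree P = total_degree f" using c assms by (simp add: P_def degree_infinity_poly)
  moreover have "lead_coeff P = 1"
    unfolding \<open>degree P = _\<close> using c by (simp add: P_def coeff_infinity_poly_total_degree c_def)
  ultimately obtain N p where Np: "N > 0" "convergent_fps p" "poly (ramify_poly N P) p = 0"
    using puiseux_root_exists[of P] assms by auto
  have "ramify_poly N P = smult (fps_const (1 / c)) (ramify_poly N (infinity_poly f))"
    using Np(1) by (simp add: poly_eq_iff P_def ramify_mult)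
  then have "poly (ramify_poly N (infinity_poly f)) p = 0" using Np c by simp
  then show ?thesis using that Np by (simp add: homogenization_eq_poly)
qed

text \<open>Setting \<open>z = 0\<close> in \<open>F(1, \<phi>(z), z) = 0\<close> leaves only the
  top homogeneous part.\<close>

lemma infinity_point_of_solution:
  fixes p :: "complex fps"
  assumes "N > 0" "homogenization fps_const f 1 p (fps_X ^ N) = 0"
  shows "infinity_point f 1 (p $ 0)"
proof -
  let ?d = "total_degree f"
  have "0 = homogenization fps_const f 1 p (fps_X ^ N) $ 0" using assms by simp
  also have "\<dots> = (\<Sum>k\<le>?d. if k = ?d then homog_part id f k 1 (p $ 0) else 0)"
    unfolding homogenization_def homog_part_def fps_sum_nth using assms(1)
    by (intro sum.cong refl) (auto simp: fps_sum_nth fps_mult_nth_0 fps_nth_power_0 power_0_left)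
  finally show ?thesis by (simp add: infinity_point_def)
qed

text \<open>The construction of a root multiplies ramification orders without any minimality, so
  \<open>N\<close> may exceed the ramification index; dividing \<open>N\<close> and all exponents by
  their gcd repairs this.\<close>

lemma reduced_representation:
  assumes "N > 0"
  obtains g K p' where "g > 0" "K > 0" "N = K * g" "p = ramify g p'" "Gcd (insert K (supp p')) = 1"
proof -
  define g where "g = Gcd (insert N (supp p))"
  have g: "g dvd N" "\<And>i. i \<in> supp p \<Longrightarrow> g dvd i" unfolding g_def by (blast intro: Gcd_dvd)+
  have g0: "g > 0" using g(1) assms by (auto intro!: Nat.gr0I)
  obtain K where K: "N = K * g" using g(1) by (metis dvd_def mult.commute)
  define p' where "p' = Abs_fps (\<lambda>i. p $ (g * i))"
  have p: "p = ramify g p'"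
    using g g0 by (auto simp: fps_eq_iff fps_nth_compose_X_power p'_def supp_def)
  have "insert N (supp p) = (*) g ` insert K (supp p')"
  proof -
    have "supp p = (*) g ` supp p'"
    proof (intro set_eqI iffI)
      fix i assume i: "i \<in> supp p"
      then obtain j where "i = g * j" using g(2) by (auto elim: dvdE)
      then show "i \<in> (*) g ` supp p'" using i by (auto simp: supp_def p'_def)
    qed (auto simp: supp_def p'_def)
    then show ?thesis using K by (simp add: mult.commute)
  qed
  then have "Gcd (insert N (supp p)) = g * Gcd (insert K (supp p'))" by (simp only: Gcd_image_mult)
  then have "g = g * Gcd (insert K (supp p'))" unfolding g_def[symmetric] .
  then have "Gcd (insert K (supp p')) = 1" using g0 by simp
  then show ?thesis using that g0 K p assms by (metis nat_0_less_mult_iff)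
qed

lemma convergent_fps_of_ramify:
  assumes "convergent_fps (ramify g p)" "g > 0"
  shows "convergent_fps p"
proof -
  obtain C R where CR: "C \<ge> 0" "R > 0" "\<And>i. cmod (ramify g p $ i) \<le> C * R ^ i"
    using convergent_fps_bound[OF assms(1)] by blast
  have "cmod (p $ i) \<le> C * (R ^ g) ^ i" for i
    using CR(3)[of "g * i"] assms(2) by (simp add: fps_nth_compose_X_power power_mult)
  then show ?thesis by (rule convergent_fpsI)
qed

lemma convergent_puiseux_solution:
  assumes "\<not> infinity_point f 0 1" "total_degree f > 0"
  obtains N p m where "N > 0" "convergent_fps p" "puiseux_solution f m (N, p)" "infinity_point f 1 m"
proof -
  obtain N p where Np: "N > 0" "convergent_fps p" "homogenization fps_const f 1 p (fps_X ^ N) = 0"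
    using convergent_puiseux_solution_exists[OF assms] .
  obtain g K p' where r: "g > 0" "K > 0" "N = K * g" "p = ramify g p'" "Gcd (insert K (supp p')) = 1"
    using reduced_representation[OF Np(1)] by blast
  have "ramify g (poly (ramify_poly K (infinity_poly f)) p') = 0"
    using Np r by (simp add: homogenization_eq_poly poly_ramify_poly[symmetric] ramify_poly_ramify_poly)
  then have sol: "homogenization fps_const f 1 p' (fps_X ^ K) = 0"
    using r by (simp add: ramify_eq_0_iff homogenization_eq_poly)
  show ?thesis
  proof (rule that[of K p' "p' $ 0"])
    show "convergent_fps p'" using Np r convergent_fps_of_ramify by blast
    show "puiseux_solution f (p' $ 0) (K, p')"
      using r sol by (simp add: puiseux_solution_def ramification_index_eq_iff)
    show "infinity_point f 1 (p' $ 0)" using infinity_point_of_solution[OF r(2) sol] .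
  qed (rule r(2))
qed

lemma puiseux_solution_iff:
  "puiseux_solution f m (N, p) \<longleftrightarrow> N > 0 \<and> Gcd (insert N (supp p)) = 1 \<and> p $ 0 = m \<and>
     poly (ramify_poly N (infinity_poly f)) p = 0"
  by (auto simp: puiseux_solution_def ramification_index_eq_iff homogenization_eq_poly)

lemma card_twists:
  assumes "N > 0" "Gcd (insert N (supp p)) = 1"
  shows "card ((\<lambda>c. twist c p) ` {c. c ^ N = 1}) = N"
  using inj_on_twist[OF assms] assms(1) by (simp add: card_image card_roots_unity_eq)

lemma ramification_le_total_degree:
  assumes "\<not> infinity_point f 0 1" "puiseux_solution f m (N, p)"
  shows "N \<le> total_degree f"
proof -
  let ?P = "ramify_poly N (infinity_poly f)"
  have sol: "N > 0" "Gcd (insert N (supp p)) = 1" "poly ?P p = 0"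
    using assms(2) by (auto simp: puiseux_solution_iff)
  have nz: "infinity_poly f \<noteq> 0"
    using assms(1) coeff_infinity_poly_total_degree[of f] by (auto simp: infinity_point_0_1_iff)
  then have "?P \<noteq> 0"
    using sol(1) by (auto simp: poly_eq_iff ramify_eq_0_iff)
  have "(\<lambda>c. twist c p) ` {c. c ^ N = 1} \<subseteq> {x. poly ?P x = 0}"
    using sol by (auto simp: poly_ramify_poly_twist)
  then have "card ((\<lambda>c. twist c p) ` {c. c ^ N = 1}) \<le> card {x. poly ?P x = 0}"
    using \<open>?P \<noteq> 0\<close> by (intro card_mono poly_roots_finite)
  also have "\<dots> \<le> degree ?P" by (rule card_poly_roots_bound[OF \<open>?P \<noteq> 0\<close>])
  also have "\<dots> = total_degree f"
    using sol(1) degree_infinity_poly[OF assms(1)] by (simp add: degree_ramify_poly)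
  finally show ?thesis using card_twists[OF sol(1,2)] by simp
qed

lemma supp_ramify: "N > 0 \<Longrightarrow> supp (ramify N p) = (*) N ` supp p"
  by (auto simp: supp_def fps_nth_compose_X_power elim!: dvdE)

text \<open>Series with different ramification become comparable as roots of one polynomial,
  ramified by \<open>N * N'\<close>, whose degree is still the total degree of
  \<open>f\<close>.\<close>

lemma maximal_solution_unique:
  assumes "\<not> infinity_point f 0 1" "puiseux_solution f m (N, p)" "N = total_degree f"
    and "puiseux_solution f m' (N', p')"
  shows "(N', p') \<in> conjugates (N, p)"
proof -
  let ?P = "ramify_poly (N * N') (infinity_poly f)"
  let ?T = "(\<lambda>c. ramify N' (twist c p)) ` {c. c ^ N = 1}"
  have sol: "N > 0" "Gcd (insert N (supp p)) = 1" "poly (ramify_poly N (infinity_poly f)) p = 0"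
    using assms(2) by (auto simp: puiseux_solution_iff)
  have sol': "N' > 0" "Gcd (insert N' (supp p')) = 1" "poly (ramify_poly N' (infinity_poly f)) p' = 0"
    using assms(4) by (auto simp: puiseux_solution_iff)
  have nz: "infinity_poly f \<noteq> 0"
    using assms(1) coeff_infinity_poly_total_degree[of f] by (auto simp: infinity_point_0_1_iff)
  then have nz': "?P \<noteq> 0"
    using sol(1) sol'(1) by (auto simp: poly_eq_iff ramify_eq_0_iff)
  have inj: "inj_on (ramify N') A" for A :: "complex fps set"
  proof (rule inj_onI)
    fix a b :: "complex fps" assume "ramify N' a = ramify N' b"
    then have "ramify N' (a - b) = 0" by (simp add: fps_compose_sub_distrib)
    then show "a = b" using sol'(1) by (simp add: ramify_eq_0_iff)
  qed
  have "?T = ramify N' ` (\<lambda>c. twist c p) ` {c. c ^ N = 1}" by (simp add: image_image)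
  then have card: "card ?T = N" using card_twists[OF sol(1,2)] card_image[OF inj] by simp
  have sub: "?T \<subseteq> {x. poly ?P x = 0}"
  proof safe
    fix c :: complex assume "c ^ N = 1"
    then have "poly (ramify_poly N (infinity_poly f)) (twist c p) = 0"
      using sol by (simp add: poly_ramify_poly_twist)
    then have "poly (ramify_poly N' (ramify_poly N (infinity_poly f))) (ramify N' (twist c p)) = 0"
      using sol'(1) by (simp add: poly_ramify_poly)
    then show "poly ?P (ramify N' (twist c p)) = 0" using sol(1) sol'(1) by (simp add: ramify_poly_ramify_poly)
  qed
  have "card {x. poly ?P x = 0} \<le> card ?T"
    using card_poly_roots_bound[OF nz'] card assms(3) degree_infinity_poly[OF assms(1)] sol(1) sol'(1)
    by (simp add: degree_ramify_poly)
  then have roots: "{x. poly ?P x = 0} = ?T"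
    using card_seteq[OF poly_roots_finite[OF nz'] sub] by simp
  have "poly (ramify_poly N (ramify_poly N' (infinity_poly f))) (ramify N p') = 0"
    using sol(1) sol' by (simp add: poly_ramify_poly)
  then have "poly ?P (ramify N p') = 0" using sol(1) sol'(1) by (simp add: ramify_poly_ramify_poly mult.commute)
  then obtain c where c: "c ^ N = 1" "ramify N p' = ramify N' (twist c p)" using roots by blast
  have c0: "c \<noteq> 0" using c sol(1) by (auto simp: power_0_left)
  have "supp (ramify N p') = (*) N' ` supp p"
    unfolding c(2) using sol'(1) c0 by (simp add: supp_ramify supp_twist)
  then have supp: "(*) N ` supp p' = (*) N' ` supp p" using sol(1) by (simp add: supp_ramify)
  \<comment> \<open>The two supports have been scaled to the same set. Its gcd together with
    \<open>N * N'\<close> is \<open>N\<close> when computed from \<open>p'\<close> and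
    \<open>N'\<close> when computed from \<open>p\<close>.\<close>
  have "N = N * Gcd (insert N' (supp p'))" using sol' by simp
  also have "\<dots> = Gcd ((*) N ` insert N' (supp p'))" by (rule Gcd_image_mult[symmetric])
  also have "(*) N ` insert N' (supp p') = (*) N' ` insert N (supp p)"
    using supp by (simp add: mult.commute)
  also have "Gcd \<dots> = N' * Gcd (insert N (supp p))" by (rule Gcd_image_mult)
  also have "\<dots> = N'" using sol by simp
  finally have "N = N'" .
  with c(2) have "p' = twist c p" using inj_onD[OF inj, of p' "twist c p" UNIV] by simp
  then show ?thesis using c(1) \<open>N = N'\<close> by (auto simp: conjugates_eq)
qed

section \<open>Leaves and approaching curves\<close>

text \<open>Needed because \<open>infdist\<close> to the empty set is 0.\<close>

lemma curve_points_nonempty: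
  assumes "irreducible g"
  shows "curve_points g \<noteq> {}"
proof (cases "degree g = 0")
  case True
  then obtain c where g: "g = [:c:]" by (rule degree_eq_zeroE)
  have "\<not> c dvd 1" "c \<noteq> 0" using assms by (auto simp: g irreducible_def is_unit_poly_iff)
  then have "degree c > 0" using is_unit_iff_degree by auto
  then have "\<not> constant (poly c)" by (simp add: constant_degree)
  then obtain x where "poly c x = 0" using fundamental_theorem_of_algebra by blast
  then show ?thesis by (auto simp: curve_points_def g)
next
  case False
  then have "lead_coeff g \<noteq> 0" by auto
  then obtain x where x: "poly (lead_coeff g) x \<noteq> 0"
    using poly_all_0_iff_0 by blast
  have "degree g \<le> degree (fiber g x)" using x by (intro le_degree) simp
  then have "\<not> constant (poly (fiber g x))" using False by (simp add: constant_degree)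
  then obtain y where "poly (fiber g x) y = 0" using fundamental_theorem_of_algebra by blast
  then show ?thesis by (auto simp: curve_points_def poly_fiber)
qed

text \<open>An \<open>e\<close>-th root of a point near \<open>s ^ e\<close> can be chosen so close to \<open>s\<close> that a polynomial of
  degree at most \<open>e\<close> changes by no more than a multiple of the displacement.\<close>

lemma nearby_root:
  fixes q :: "complex poly"
  assumes "e > 0" "degree q \<le> e"
  shows "\<exists>C\<ge>0. \<exists>S>0. \<forall>s x. cmod s \<ge> S \<longrightarrow> cmod (x - s ^ e) \<le> 1 \<longrightarrow>
    (\<exists>t. t ^ e = x \<and> cmod t \<ge> cmod s / 2 \<and> cmod (poly q t - poly q s) \<le> C * cmod (x - s ^ e))"
proof -
  \<comment> \<open>The principal root is continuous at 1, and the root sought is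
    \<open>s * v u\<close> with \<open>u = x / s ^ e\<close>, which is close to 1 for large
    \<open>s\<close>.\<close>
  define v where "v u = u powr (1 / of_nat e)" for u :: complex
  have v_pow: "v u ^ e = u" if "u \<noteq> 0" for u
    using that assms(1) by (simp add: v_def powr_def exp_of_nat_mult[symmetric])
  have "isCont v 1" unfolding v_def by (intro continuous_intros) auto
  then have v1: "(v \<longlongrightarrow> 1) (at 1)" by (simp add: isCont_def v_def)
  \<comment> \<open>This sum is the cofactor of \<open>v u - 1\<close> in
    \<open>u - 1 = v u ^ e - 1\<close>. Being close to \<open>e\<close>, it has modulus at least
    1/2, so \<open>u - 1\<close> controls \<open>v u - 1\<close>.\<close>
  then have "((\<lambda>u. \<Sum>i<e. v u ^ i) \<longlongrightarrow> (\<Sum>i<e. 1 ^ i)) (at 1)" by (intro tendsto_intros)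
  then have "\<forall>\<^sub>F u in at 1. dist (\<Sum>i<e. v u ^ i) (of_nat e) < 1/2"
    by (intro tendstoD) simp_all
  moreover have "\<forall>\<^sub>F u in at 1. dist (v u) 1 < 1/2" using v1 by (intro tendstoD) simp_all
  ultimately have "\<forall>\<^sub>F u in at 1. dist (\<Sum>i<e. v u ^ i) (of_nat e) < 1/2 \<and> dist (v u) 1 < 1/2"
    by (rule eventually_conj)
  then obtain d where d: "d > 0" "\<And>u. u \<noteq> 1 \<Longrightarrow> dist u 1 < d \<Longrightarrow>
      dist (\<Sum>i<e. v u ^ i) (of_nat e) < 1/2 \<and> dist (v u) 1 < 1/2"
    by (auto simp: eventually_at)
  have near: "dist (\<Sum>i<e. v u ^ i) (of_nat e) < 1/2" "dist (v u) 1 < 1/2" if "dist u 1 < d" for u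
    using d(2)[OF _ that] by (cases "u = 1"; simp add: v_def)+
  define C where "C = (\<Sum>i\<le>e. cmod (coeff q i) * (real i * 2 ^ i)) * 2"
  show ?thesis
  proof (rule exI[of _ C], rule conjI)
    show "C \<ge> 0" by (auto simp: C_def intro!: sum_nonneg)
    show "\<exists>S>0. \<forall>s x. cmod s \<ge> S \<longrightarrow> cmod (x - s ^ e) \<le> 1 \<longrightarrow>
      (\<exists>t. t ^ e = x \<and> cmod t \<ge> cmod s / 2 \<and> cmod (poly q t - poly q s) \<le> C * cmod (x - s ^ e))"
    proof (rule exI[of _ "max 1 (2 / d) + 1"], intro conjI allI impI)
      show "max 1 (2 / d) + 1 > 0" by simp
      fix s x assume s: "cmod s \<ge> max 1 (2 / d) + 1" and x: "cmod (x - s ^ e) \<le> 1"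
      have s1: "cmod s > 1" "cmod s > 2 / d" using s by auto
      have s0: "s \<noteq> 0" using s1 by auto
      define u where "u = x / s ^ e"
      have u1: "u - 1 = (x - s ^ e) / s ^ e" using s0 by (simp add: u_def field_simps)
      have se: "cmod s \<le> cmod s ^ e" using s1(1) assms(1) by (intro self_le_power) auto
      have "cmod (u - 1) \<le> 1 / cmod s"
        unfolding u1 norm_divide norm_power using x se s1 by (intro frac_le) auto
      also have "\<dots> < d"
      proof -
        have "2 < d * cmod s" using s1 d(1) by (simp add: divide_less_eq mult.commute)
        then have "1 < d * cmod s" by simp
        moreover have "cmod s > 0" using s1 by linarith
        ultimately show ?thesis by (simp add: divide_less_eq)
      qed
      finally have du: "dist u 1 < d" by (simp add: dist_norm)
      have "1 / cmod s < 1" using s1 by (subst divide_less_eq_1_pos) linarith+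
      then have u0: "u \<noteq> 0" using \<open>cmod (u - 1) \<le> 1 / cmod s\<close> by auto
      have vb: "cmod (v u) \<le> 2" "cmod (v u) \<ge> 1 / 2"
        using near(2)[OF du] norm_triangle_ineq2[of "v u" 1] norm_triangle_ineq2[of 1 "v u"]
        by (auto simp: dist_norm norm_minus_commute)
      have "1 / 2 \<le> cmod (\<Sum>i<e. v u ^ i)"
        using near(1)[OF du] norm_triangle_ineq2[of "of_nat e" "\<Sum>i<e. v u ^ i"] assms(1)
        by (simp add: dist_norm norm_minus_commute)
      then have "cmod (v u - 1) * (1 / 2) \<le> cmod (v u - 1) * cmod (\<Sum>i<e. v u ^ i)"
        by (intro mult_left_mono) auto
      also have "\<dots> = cmod (u - 1)"
        unfolding norm_mult[symmetric] power_diff_1_eq[symmetric] using v_pow[OF u0] by simp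
      finally have vu: "cmod (v u - 1) \<le> 2 * cmod (u - 1)" by simp
      have vi: "cmod (v u ^ i - 1) \<le> real i * 2 ^ i * (2 * cmod (u - 1))" for i
      proof -
        have "cmod (v u ^ i - 1) = cmod (v u - 1) * cmod (\<Sum>j<i. v u ^ j)"
          by (simp add: power_diff_1_eq norm_mult)
        also have "\<dots> \<le> (2 * cmod (u - 1)) * (\<Sum>j<i. 2 ^ i)"
        proof (intro mult_mono vu order_trans[OF norm_sum] sum_mono)
          fix j assume "j \<in> {..<i}"
          have "cmod (v u ^ j) \<le> 2 ^ j" unfolding norm_power using vb by (intro power_mono) auto
          also have "\<dots> \<le> 2 ^ i" using \<open>j \<in> {..<i}\<close> by (intro power_increasing) auto
          finally show "cmod (v u ^ j) \<le> 2 ^ i" .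
        qed auto
        finally show ?thesis by (simp add: mult_ac)
      qed
      define t where "t = s * v u"
      have t_pow: "t ^ e = x" using v_pow[OF u0] s0 by (simp add: t_def power_mult_distrib u_def)
      have t_norm: "cmod t \<ge> cmod s / 2" using vb(2) mult_left_mono[OF vb(2), of "cmod s"] by (simp add: t_def norm_mult)
      \<comment> \<open>Each monomial has degree at most \<open>e\<close> and thus costs at most the
        factor \<open>cmod s ^ e\<close>, which cancels against the denominator of
        \<open>u - 1\<close>.\<close>
      have "poly q t - poly q s = (\<Sum>i\<le>e. coeff q i * (s ^ i * (v u ^ i - 1)))"
        by (simp add: poly_eq_sum_le[OF assms(2)] t_def power_mult_distrib right_diff_distrib flip: sum_subtractf)
      also have "cmod \<dots> \<le> (\<Sum>i\<le>e. cmod (coeff q i) * (cmod s ^ e * (real i * 2 ^ i * (2 * cmod (u - 1)))))"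
      proof (intro order_trans[OF norm_sum] sum_mono)
        fix i assume "i \<in> {..e}"
        then have "cmod s ^ i \<le> cmod s ^ e" using s1 by (intro power_increasing) auto
        then show "cmod (coeff q i * (s ^ i * (v u ^ i - 1)))
            \<le> cmod (coeff q i) * (cmod s ^ e * (real i * 2 ^ i * (2 * cmod (u - 1))))"
          unfolding norm_mult norm_power using vi by (intro mult_left_mono mult_mono) auto
      qed
      also have "\<dots> = C * (cmod s ^ e * cmod (u - 1))"
        by (simp add: C_def sum_distrib_left sum_distrib_right mult_ac)
      also have "cmod s ^ e * cmod (u - 1) = cmod (x - s ^ e)"
        using s0 by (simp add: u1 norm_divide norm_power)
      finally have "cmod (poly q t - poly q s) \<le> C * cmod (x - s ^ e)" .
      with t_pow t_norm show "\<exists>t. t ^ e = x \<and> cmod t \<ge> cmod s / 2 \<and> cmod (poly q t - poly q s) \<le> C * cmod (x - s ^ e)"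
        by blast
    qed
  qed
qed

text \<open>With \<open>\<tau> = leaf_param (N, p) z\<close>, so that \<open>z = 1 / \<tau> ^ N\<close>, the terms of the leaf with non-negative exponent
  form the polynomial \<open>q\<close> in \<open>\<sigma> z = 1 / \<tau> ^ b\<close>, and \<open>\<sigma> z ^ e = z\<close>; here \<open>e\<close> is the degree of the branch.\<close>

locale convergent_leaf =
  fixes N :: nat and p :: "complex fps"
  assumes N: "N > 0" and conv: "convergent_fps p"
begin

definition b where "b = Gcd (insert N {i. 0 < i \<and> i \<le> N \<and> p $ i \<noteq> 0})"
definition e where "e = N div b"
definition q where "q = (\<Sum>i\<le>e. monom (p $ (b * i)) (e - i))"
definition \<sigma> where "\<sigma> z = 1 / leaf_param (N, p) z ^ b"

lemma puiseux_degree_eq: "puiseux_degree (N, p) = e"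
  by (simp add: puiseux_degree_def e_def b_def)

lemma b_dvd: "i = N \<or> (0 < i \<and> i \<le> N \<and> p $ i \<noteq> 0) \<Longrightarrow> b dvd i"
  unfolding b_def by (rule Gcd_dvd) auto

lemma b: "b > 0" and N_eq: "N = e * b" and e: "e > 0"
proof -
  show 1: "b > 0" using b_dvd[of N] N by (auto intro!: Nat.gr0I)
  show 2: "N = e * b" using b_dvd[of N] by (simp add: e_def)
  show "e > 0" using 2 N by (auto intro!: Nat.gr0I)
qed

lemma coeff_q: "k \<le> e \<Longrightarrow> coeff q k = p $ (b * (e - k))"
proof -
  assume k: "k \<le> e"
  have "coeff q k = (\<Sum>i\<le>e. if i = e - k then p $ (b * i) else 0)"
    unfolding q_def coeff_sum using k by (intro sum.cong) auto
  then show ?thesis by simp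
qed

lemma degree_q: "degree q \<le> e"
  unfolding q_def by (intro degree_sum_le order_trans[OF degree_monom_le]) auto

text \<open>A rotation by \<open>z\<close> that preserves \<open>q\<close> satisfies
  \<open>z ^ (e - k) = 1\<close>, hence \<open>z ^ k = 1\<close>, for every index
  \<open>b * k\<close> in the truncated support. These \<open>k\<close> together with
  \<open>e\<close> have gcd 1, since \<open>b\<close> has been divided out.\<close>

sublocale primitive_parametrization e q
proof
  fix z assume z: "z ^ e = 1" and inv: "\<And>s. poly q (z * s) = poly q s"
  have "pcompose q (monom z (Suc 0)) = q"
    unfolding poly_eq_poly_eq_iff[symmetric] fun_eq_iff
    using inv by (simp add: poly_pcompose poly_monom)
  then have c: "z ^ k * coeff q k = coeff q k" for k
    by (metis coeff_pcompose_monom_linear)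
  let ?A = "insert N {i. 0 < i \<and> i \<le> N \<and> p $ i \<noteq> 0}"
  have "b * (i div b) = i" if "i \<in> ?A" for i
    using that b_dvd[of i] by (intro dvd_mult_div_cancel) auto
  then have "(\<lambda>i. b * (i div b)) ` ?A = (\<lambda>i. i) ` ?A" by (rule image_cong[OF refl])
  then have A: "?A = (*) b ` ((\<lambda>i. i div b) ` ?A)" by (simp only: image_image image_ident)
  have "Gcd ?A = b * Gcd ((\<lambda>i. i div b) ` ?A)"
    by (subst A) (rule Gcd_image_mult)
  then have "b = b * Gcd ((\<lambda>i. i div b) ` ?A)" unfolding b_def[symmetric] .
  moreover have "k = 1" if "b = b * k" for k using that b by simp
  ultimately have gcd: "Gcd ((\<lambda>i. i div b) ` ?A) = 1" by blast
  have "z ^ k = 1" if "k \<in> (\<lambda>i. i div b) ` ?A" for k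
  proof -
    from that obtain i where i: "i \<in> ?A" "k = i div b" by blast
    show ?thesis
    proof (cases "i = N")
      case True
      then show ?thesis using z i by (simp add: e_def)
    next
      case False
      then have i': "i \<le> N" "p $ i \<noteq> 0" "b dvd i" using i b_dvd[of i] by auto
      then have bk: "b * k = i" using i by simp
      then have ke: "k \<le> e" using i'(1) b N_eq by (metis mult.commute mult_le_cancel2)
      then have "coeff q (e - k) = p $ i" using coeff_q[of "e - k"] bk by simp
      then have "z ^ (e - k) = 1" using c[of "e - k"] i'(2) by simp
      moreover have "z ^ e = z ^ (e - k) * z ^ k" using ke by (simp flip: power_add)
      ultimately show ?thesis using z by simp
    qed
  qed
  moreover have "e \<in> (\<lambda>i. i div b) ` ?A" by (auto simp: e_def)
  ultimately have "z ^ Gcd ((\<lambda>i. i div b) ` ?A) = 1" using e by (intro power_Gcd_eq_1[of e]) auto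
  then show "z = 1" using gcd by simp
qed (use e degree_q in auto)

lemma poly_q_inverse:
  assumes "\<tau> \<noteq> 0"
  shows "poly q (1 / \<tau> ^ b) = (\<Sum>k\<le>N. p $ k * \<tau> ^ k) / \<tau> ^ N"
proof -
  have "(\<Sum>k\<le>N. p $ k * \<tau> ^ k) = (\<Sum>k\<in>(*) b ` {..e}. p $ k * \<tau> ^ k)"
  proof (rule sum.mono_neutral_right)
    show "(*) b ` {..e} \<subseteq> {..N}"
    proof clarify
      fix i assume "i \<le> e"
      then have "b * i \<le> b * e" by simp
      then show "b * i \<le> N" using N_eq by (metis mult.commute)
    qed
    show "\<forall>k\<in>{..N} - (*) b ` {..e}. p $ k * \<tau> ^ k = 0"
    proof (intro ballI, rule ccontr)
      fix k assume k: "k \<in> {..N} - (*) b ` {..e}" and "p $ k * \<tau> ^ k \<noteq> 0"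
      \<comment> \<open>The index 0 is not among the arguments of the gcd \<open>b\<close>, but it
        is divisible by \<open>b\<close> anyway.\<close>
      then have "b dvd k" using b_dvd[of k] by (cases "k = 0") auto
      then obtain j where j: "k = b * j" ..
      then have "b * j \<le> b * e" using k N_eq by (metis DiffD1 atMost_iff mult.commute)
      then have "j \<le> e" using b by simp
      then show False using k j by blast
    qed
  qed auto
  also have "\<dots> = (\<Sum>i\<le>e. p $ (b * i) * \<tau> ^ (b * i))"
    using b by (subst sum.reindex) (auto simp: inj_on_def)
  finally have "(\<Sum>k\<le>N. p $ k * \<tau> ^ k) / \<tau> ^ N = (\<Sum>i\<le>e. p $ (b * i) * (\<tau> ^ (b * i) / \<tau> ^ N))"
    by (simp add: sum_divide_distrib)
  also have "\<dots> = (\<Sum>i\<le>e. p $ (b * i) * (1 / \<tau> ^ b) ^ (e - i))"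
  proof (rule sum.cong[OF refl])
    fix i assume "i \<in> {..e}"
    then have "b * e = b * i + b * (e - i)" by (simp flip: add_mult_distrib2)
    then have "N = b * i + b * (e - i)" using N_eq by (metis mult.commute)
    from arg_cong[OF this, of "\<lambda>n. \<tau> ^ n"]
    have "\<tau> ^ N = \<tau> ^ (b * i) * (\<tau> ^ b) ^ (e - i)" by (simp only: power_add power_mult)
    then show "p $ (b * i) * (\<tau> ^ (b * i) / \<tau> ^ N) = p $ (b * i) * (1 / \<tau> ^ b) ^ (e - i)"
      using assms by (simp add: power_divide)
  qed
  finally show ?thesis by (simp add: q_def poly_sum poly_monom)
qed

lemma leaf_param_power: "z \<noteq> 0 \<Longrightarrow> leaf_param (N, p) z ^ N = 1 / z"
  using N by (simp add: leaf_param_def powr_def exp_of_nat_mult[symmetric])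

lemma leaf_param_nonzero: "z \<noteq> 0 \<Longrightarrow> leaf_param (N, p) z \<noteq> 0"
  by (simp add: leaf_param_def powr_def)

lemma norm_leaf_param_less:
  assumes "r > 0" "cmod z > (1 / r) ^ N"
  shows "cmod (leaf_param (N, p) z) < r"
proof (rule ccontr)
  assume "\<not> ?thesis"
  then have "r ^ N \<le> cmod (leaf_param (N, p) z) ^ N" using assms by (intro power_mono) auto
  moreover have z: "z \<noteq> 0" using assms by (metis norm_zero zero_less_divide_1_iff zero_less_power order_less_asym)
  ultimately have "r ^ N \<le> 1 / cmod z"
    by (metis leaf_param_power norm_divide norm_one norm_power)
  moreover have "1 / cmod z < r ^ N" using assms z by (simp add: field_simps)
  ultimately show False by simp
qed

lemma filterlim_leaf_param: "filterlim (leaf_param (N, p)) (at 0) at_infinity"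
  unfolding filterlim_at
proof
  show "\<forall>\<^sub>F z in at_infinity. leaf_param (N, p) z \<in> UNIV \<and> leaf_param (N, p) z \<noteq> 0"
    unfolding eventually_at_infinity
  proof (rule exI[of _ 1], intro allI impI)
    fix z assume "1 \<le> cmod z"
    then have "z \<noteq> 0" by auto
    then show "leaf_param (N, p) z \<in> UNIV \<and> leaf_param (N, p) z \<noteq> 0"
      by (simp add: leaf_param_nonzero)
  qed
  show "(leaf_param (N, p) \<longlongrightarrow> 0) at_infinity"
  proof (rule tendstoI)
    fix r :: real assume r: "r > 0"
    show "\<forall>\<^sub>F z in at_infinity. dist (leaf_param (N, p) z) 0 < r"
      unfolding eventually_at_infinity
      using norm_leaf_param_less[OF r] by (intro exI[of _ "(1 / r) ^ N + 1"]) auto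
  qed
qed

text \<open>The polynomial \<open>q\<close> accounts for the indices up to and including
  \<open>N\<close>, the constant term of the leaf. The rest is divisible by
  \<open>\<tau> ^ (N + 1)\<close>, so after division by \<open>\<tau> ^ N\<close> a factor
  \<open>\<tau>\<close> remains.\<close>

lemma leaf_tail: "((\<lambda>\<tau>. eval_fps p \<tau> / \<tau> ^ N - poly q (1 / \<tau> ^ b)) \<longlongrightarrow> 0) (at 0)"
proof -
  define h where "h = fps_shift (Suc N) p"
  have h: "fps_conv_radius h > 0" using conv by (simp add: h_def convergent_fps_def)
  have "isCont (eval_fps h) 0" using h by (intro continuous_intros) (simp add: zero_ereal_def)
  then have "(eval_fps h \<longlongrightarrow> eval_fps h 0) (at 0)" by (simp add: isCont_def)
  then have lim: "((\<lambda>\<tau>. \<tau> * eval_fps h \<tau>) \<longlongrightarrow> 0 * eval_fps h 0) (at 0)" by (intro tendsto_intros)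
  obtain r where r: "r > 0" "ereal r < fps_conv_radius p"
    using conv ereal_dense2[of 0 "fps_conv_radius p"]
    unfolding convergent_fps_def by (metis ereal_less(2) zero_ereal_def)
  have eq: "eval_fps p \<tau> / \<tau> ^ N - poly q (1 / \<tau> ^ b) = \<tau> * eval_fps h \<tau>"
    if "\<tau> \<noteq> 0" "cmod \<tau> < r" for \<tau>
  proof -
    have "ereal (cmod \<tau>) < fps_conv_radius p"
      using that r by (metis ereal_less_eq(3) less_le_trans not_le order_less_imp_le)
    then have sum: "summable (\<lambda>n. p $ n * \<tau> ^ n)" by (rule summable_fps)
    have "eval_fps p \<tau> = (\<Sum>n. p $ (n + Suc N) * \<tau> ^ (n + Suc N)) + (\<Sum>k<Suc N. p $ k * \<tau> ^ k)"
      unfolding eval_fps_def by (rule suminf_split_initial_segment[OF sum])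
    also have "(\<Sum>n. p $ (n + Suc N) * \<tau> ^ (n + Suc N)) = (\<Sum>n. \<tau> ^ Suc N * (h $ n * \<tau> ^ n))"
      by (simp add: h_def power_add mult_ac)
    also have "\<dots> = \<tau> ^ Suc N * eval_fps h \<tau>"
    proof -
      have "summable (\<lambda>n. h $ n * \<tau> ^ n)"
        using \<open>ereal (cmod \<tau>) < fps_conv_radius p\<close> by (intro summable_fps) (simp add: h_def)
      then show ?thesis unfolding eval_fps_def by (rule suminf_mult)
    qed
    finally show ?thesis
      using that by (simp add: poly_q_inverse lessThan_Suc_atMost add_divide_distrib)
  qed
  have "\<forall>\<^sub>F \<tau> in at 0. \<tau> * eval_fps h \<tau> = eval_fps p \<tau> / \<tau> ^ N - poly q (1 / \<tau> ^ b)"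
    unfolding eventually_at using r eq by (intro exI[of _ r]) auto
  from Lim_transform_eventually[OF lim this] show ?thesis by simp
qed

lemma \<sigma>_power: "z \<noteq> 0 \<Longrightarrow> \<sigma> z ^ e = z"
  using leaf_param_power[of z] N_eq
  by (simp add: \<sigma>_def power_divide power_mult[symmetric] mult.commute)

lemma norm_\<sigma>_ge:
  assumes "S > 0" "cmod z \<ge> S ^ e"
  shows "cmod (\<sigma> z) \<ge> S"
proof (rule ccontr)
  assume "\<not> ?thesis"
  then have "cmod (\<sigma> z) ^ e < S ^ e" using e by (intro power_strict_mono) auto
  moreover have "z \<noteq> 0" using assms by (metis norm_zero not_le zero_less_power)
  ultimately show False using assms \<sigma>_power[of z] by (metis norm_power not_le)
qed

lemma leaf_asymptotics: "((\<lambda>z. leaf_fun (N, p) z - poly q (\<sigma> z)) \<longlongrightarrow> 0) at_infinity"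
proof -
  have "((\<lambda>z. eval_fps p (leaf_param (N, p) z) / leaf_param (N, p) z ^ N - poly q (1 / leaf_param (N, p) z ^ b))
      \<longlongrightarrow> 0) at_infinity"
    by (rule filterlim_compose[OF leaf_tail filterlim_leaf_param])
  moreover have "\<forall>\<^sub>F z in at_infinity. leaf_fun (N, p) z - poly q (\<sigma> z) =
      eval_fps p (leaf_param (N, p) z) / leaf_param (N, p) z ^ N - poly q (1 / leaf_param (N, p) z ^ b)"
    unfolding eventually_at_infinity
  proof (rule exI[of _ 1], intro allI impI)
    fix z assume "1 \<le> cmod z"
    then have "z \<noteq> 0" by auto
    then show "leaf_fun (N, p) z - poly q (\<sigma> z) =
      eval_fps p (leaf_param (N, p) z) / leaf_param (N, p) z ^ N - poly q (1 / leaf_param (N, p) z ^ b)"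
      by (simp add: leaf_fun_def \<sigma>_def leaf_param_power)
  qed
  ultimately show ?thesis by (simp cong: tendsto_cong)
qed

lemma leaf_converges_eventually: "\<exists>M>0. leaf_converges (N, p) M"
proof -
  obtain r where r: "r > 0" "ereal r < fps_conv_radius p"
    using conv ereal_dense2[of 0 "fps_conv_radius p"]
    unfolding convergent_fps_def by (metis ereal_less(2) zero_ereal_def)
  have "leaf_converges (N, p) ((1 / r) ^ N)"
    unfolding leaf_converges_def
  proof (intro allI impI)
    fix z assume "cmod z > (1 / r) ^ N"
    then have "cmod (leaf_param (N, p) z) < r" using r(1) norm_leaf_param_less by blast
    then have "ereal (cmod (leaf_param (N, p) z)) < fps_conv_radius p"
      using r by (metis ereal_less_eq(3) less_le_trans not_le order_less_imp_le)
    then show "summable (\<lambda>i. snd (N, p) $ i * leaf_param (N, p) z ^ i)"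
      using summable_fps by simp
  qed
  moreover have "(1 / r) ^ N > 0" using r by simp
  ultimately show ?thesis by blast
qed

text \<open>The point \<open>(z, q (\<sigma> z))\<close> lies on the implicit curve over the same
  abscissa as the leaf point, so the distance is at most the vertical one, which tends to 0.\<close>

lemma approached_by_implicit_poly: "approaches implicit_poly (conjugates (N, p))"
proof -
  have "((\<lambda>z. infdist (z, leaf_fun (N, p) z) (curve_points implicit_poly)) \<longlongrightarrow> 0) at_infinity"
  proof (rule Lim_null_comparison[OF _ leaf_asymptotics[THEN tendsto_norm_zero]])
    show "\<forall>\<^sub>F z in at_infinity. norm (infdist (z, leaf_fun (N, p) z) (curve_points implicit_poly))
        \<le> norm (leaf_fun (N, p) z - poly q (\<sigma> z))"
      unfolding eventually_at_infinity
    proof (rule exI[of _ 1], intro allI impI)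
      fix z assume "1 \<le> cmod z"
      then have z: "z \<noteq> 0" by auto
      have "(z, poly q (\<sigma> z)) \<in> curve_points implicit_poly"
        using implicit_poly_on_curve[of "\<sigma> z"] \<sigma>_power[OF z] by (simp add: curve_points_def)
      then have "infdist (z, leaf_fun (N, p) z) (curve_points implicit_poly)
          \<le> dist (z, leaf_fun (N, p) z) (z, poly q (\<sigma> z))" by (rule infdist_le)
      then show "norm (infdist (z, leaf_fun (N, p) z) (curve_points implicit_poly))
          \<le> norm (leaf_fun (N, p) z - poly q (\<sigma> z))"
        by (simp add: infdist_nonneg dist_Pair_Pair dist_norm)
    qed
  qed
  then show ?thesis
    unfolding approaches_def using self_in_conjugates[of N p] leaf_converges_eventually by blast
qed

text \<open>A point \<open>(x, y)\<close> of the other curve near the leaf lies over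
  \<open>x\<close>, not over \<open>z\<close>. Writing \<open>x = t ^ e\<close> with
  \<open>t\<close> near \<open>\<sigma> z\<close> turns it into \<open>(t ^ e, q t + w)\<close> with
  small \<open>w\<close>, and such points are excluded by \<open>curve_stays_away\<close>.\<close>

lemma not_approached_by_low_degree:
  assumes g: "irreducible g" "degree g < e"
  shows "\<not> ((\<lambda>z. infdist (z, leaf_fun (N, p) z) (curve_points g)) \<longlongrightarrow> 0) at_infinity"
proof
  assume lim: "((\<lambda>z. infdist (z, leaf_fun (N, p) z) (curve_points g)) \<longlongrightarrow> 0) at_infinity"
  have "g \<noteq> 0" using g by auto
  then obtain \<delta> S where \<delta>: "\<delta> > 0"
    and away: "\<forall>s w. cmod s \<ge> S \<longrightarrow> cmod w \<le> \<delta> \<longrightarrow> poly (poly g [:poly q s + w:]) (s ^ e) \<noteq> 0"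
    using curve_stays_away g(2) by blast
  obtain C S' where C: "C \<ge> 0" "S' > 0" and root: "\<forall>s x. cmod s \<ge> S' \<longrightarrow> cmod (x - s ^ e) \<le> 1 \<longrightarrow>
    (\<exists>t. t ^ e = x \<and> cmod t \<ge> cmod s / 2 \<and> cmod (poly q t - poly q s) \<le> C * cmod (x - s ^ e))"
    using nearby_root[OF e degree_q] by blast
  \<comment> \<open>Errors of \<open>\<delta> / 3\<close> are allotted to the vertical part of the
    distance, to the tail of the leaf, and to the change of \<open>q\<close> under the horizontal
    displacement, which costs the factor \<open>C\<close>. The entry 1 is the range of validity of
    \<open>root\<close>.\<close>
  define \<epsilon> where "\<epsilon> = min 1 (\<delta> / 3 / (C + 1))"
  have \<epsilon>: "\<epsilon> > 0" "\<epsilon> \<le> 1" "C * \<epsilon> \<le> \<delta> / 3" "\<epsilon> \<le> \<delta> / 3"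
  proof -
    show "\<epsilon> > 0" "\<epsilon> \<le> 1" using \<delta> C by (auto simp: \<epsilon>_def)
    have "(C + 1) * \<epsilon> \<le> (C + 1) * (\<delta> / 3 / (C + 1))"
      using C by (intro mult_left_mono) (auto simp: \<epsilon>_def)
    also have "\<dots> = \<delta> / 3"
    proof -
      have "k * (x / k) = x" if "k > 0" for k x :: real using that by simp
      from this[of "C + 1"] show ?thesis using C(1) by (simp only: add_nonneg_pos zero_less_one)
    qed
    finally have "C * \<epsilon> + \<epsilon> \<le> \<delta> / 3" by (simp add: algebra_simps)
    moreover have "C * \<epsilon> \<ge> 0" using C \<open>\<epsilon> > 0\<close> by simp
    ultimately show "C * \<epsilon> \<le> \<delta> / 3" "\<epsilon> \<le> \<delta> / 3" using \<open>\<epsilon> > 0\<close> by linarith+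
  qed
  \<comment> \<open>The root \<open>t\<close> has at least half the modulus of
    \<open>\<sigma> z\<close> and must still reach \<open>S\<close>, hence the factor 2.\<close>
  define R where "R = max S' (2 * \<bar>S\<bar>)"
  have R: "R > 0" using C by (simp add: R_def)
  have "\<forall>\<^sub>F z in at_infinity. dist (infdist (z, leaf_fun (N, p) z) (curve_points g)) 0 < \<epsilon>"
    using lim \<epsilon> by (intro tendstoD)
  moreover have "\<forall>\<^sub>F z in at_infinity. dist (leaf_fun (N, p) z - poly q (\<sigma> z)) 0 < \<delta> / 3"
    using leaf_asymptotics \<delta> by (intro tendstoD) auto
  moreover have "\<forall>\<^sub>F z in at_infinity. cmod (z::complex) \<ge> max 1 (R ^ e)"
    unfolding eventually_at_infinity by blast
  ultimately have "\<forall>\<^sub>F z in at_infinity. infdist (z, leaf_fun (N, p) z) (curve_points g) < \<epsilon> \<and>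
      cmod (leaf_fun (N, p) z - poly q (\<sigma> z)) < \<delta> / 3 \<and> cmod z \<ge> max 1 (R ^ e)"
    by eventually_elim (simp add: infdist_nonneg)
  then obtain z where z: "infdist (z, leaf_fun (N, p) z) (curve_points g) < \<epsilon>"
      "cmod (leaf_fun (N, p) z - poly q (\<sigma> z)) < \<delta> / 3" "cmod z \<ge> max 1 (R ^ e)"
    using eventually_happens'[OF trivial_limit_at_infinity] by blast
  have ne: "curve_points g \<noteq> {}" by (rule curve_points_nonempty[OF g(1)])
  then obtain x y where xy: "(x, y) \<in> curve_points g" "dist (z, leaf_fun (N, p) z) (x, y) < \<epsilon>"
    using z(1) unfolding infdist_notempty[OF ne]
    by (subst (asm) cINF_less_iff) (auto intro!: bdd_belowI[of _ 0])
  have z0: "z \<noteq> 0" using z(3) by auto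
  have xz: "cmod (x - z) < \<epsilon>" "cmod (y - leaf_fun (N, p) z) < \<epsilon>"
    using xy(2) dist_fst_le[of "(z, leaf_fun (N, p) z)" "(x, y)"] dist_snd_le[of "(z, leaf_fun (N, p) z)" "(x, y)"]
    by (auto simp: dist_norm norm_minus_commute)
  have s: "cmod (\<sigma> z) \<ge> R" using z(3) R by (intro norm_\<sigma>_ge) auto
  have "cmod (\<sigma> z) \<ge> S'" "cmod (x - \<sigma> z ^ e) \<le> 1" using s xz \<epsilon> \<sigma>_power[OF z0] by (auto simp: R_def)
  then obtain t where t: "t ^ e = x" "cmod t \<ge> cmod (\<sigma> z) / 2"
    "cmod (poly q t - poly q (\<sigma> z)) \<le> C * cmod (x - \<sigma> z ^ e)"
    using root by blast
  have "C * cmod (x - \<sigma> z ^ e) \<le> C * \<epsilon>"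
    using xz C \<sigma>_power[OF z0] by (intro mult_left_mono) auto
  then have "cmod (poly q t - poly q (\<sigma> z)) \<le> \<delta> / 3" using t \<epsilon> by linarith
  moreover have "y - poly q t = (y - leaf_fun (N, p) z) + (leaf_fun (N, p) z - poly q (\<sigma> z)) - (poly q t - poly q (\<sigma> z))"
    by simp
  then have "cmod (y - poly q t) \<le> cmod (y - leaf_fun (N, p) z) + cmod (leaf_fun (N, p) z - poly q (\<sigma> z)) + cmod (poly q t - poly q (\<sigma> z))"
    using norm_triangle_ineq4[of "(y - leaf_fun (N, p) z) + (leaf_fun (N, p) z - poly q (\<sigma> z))" "poly q t - poly q (\<sigma> z)"]
      norm_triangle_ineq[of "y - leaf_fun (N, p) z" "leaf_fun (N, p) z - poly q (\<sigma> z)"]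
    by simp
  ultimately have "cmod (y - poly q t) \<le> \<delta>" using xz \<epsilon> z(2) by linarith
  moreover have "cmod t \<ge> S" using t(2) s by (auto simp: R_def)
  ultimately have "poly (poly g [:poly q t + (y - poly q t):]) (t ^ e) \<noteq> 0" using away by blast
  then show False using xy(1) t(1) by (simp add: curve_points_def)
qed

end

section \<open>From leaves to branches, and the equivalence\<close>

lemma leaf_converges_imp_convergent:
  assumes "leaf_converges (N, p) M" "N > 0"
  shows "convergent_fps p"
proof -
  define z where "z = complex_of_real (\<bar>M\<bar> + 1)"
  define \<tau> where "\<tau> = leaf_param (N, p) z"
  have "cmod z > M" "z \<noteq> 0" unfolding z_def by (auto simp del: of_real_add)
  then have "summable (\<lambda>i. p $ i * \<tau> ^ i)"
    using assms by (auto simp: leaf_converges_def \<tau>_def)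
  then have "conv_radius (\<lambda>i. p $ i) \<ge> cmod \<tau>" by (rule conv_radius_geI)
  moreover have "\<tau> \<noteq> 0" using \<open>z \<noteq> 0\<close> by (simp add: \<tau>_def leaf_param_def powr_def)
  ultimately have "0 < ereal (cmod \<tau>)" "ereal (cmod \<tau>) \<le> fps_conv_radius p"
    by (auto simp: fps_conv_radius_def)
  then show ?thesis unfolding convergent_fps_def by (rule less_le_trans)
qed

text \<open>Approach comes with a convergent leaf, so the branch itself may be given formally. The
  leaf may belong to another conjugate, which has the same degree.\<close>

lemma not_approaches_low_degree:
  assumes "irreducible g" "degree g < puiseux_degree (N, p)" "N > 0"
  shows "\<not> approaches g (conjugates (N, p))"
proof
  assume "approaches g (conjugates (N, p))"
  then obtain \<phi> M where \<phi>: "\<phi> \<in> conjugates (N, p)" "leaf_converges \<phi> M"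
    and lim: "((\<lambda>z. infdist (z, leaf_fun \<phi> z) (curve_points g)) \<longlongrightarrow> 0) at_infinity"
    by (auto simp: approaches_def)
  obtain p' where p': "\<phi> = (N, p')" using \<phi>(1) by (auto simp: conjugates_eq)
  interpret convergent_leaf N p'
    using leaf_converges_imp_convergent \<phi>(2) assms(3) p' by unfold_locales auto
  have "degree g < e"
    using assms branch_degree_conjugates(1)[OF \<phi>(1)] puiseux_degree_eq p' by simp
  then show False using not_approached_by_low_degree assms(1) lim p' by blast
qed

lemma total_degree_pos:
  fixes g :: "complex poly poly"
  assumes "irreducible g"
  shows "total_degree g > 0"
proof (rule ccontr)
  assume "\<not> ?thesis"
  then have 0: "coeff (coeff g j) i = 0" if "i > 0 \<or> j > 0" for i j
    using le_total_degree[of g j i] that by auto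
  define c where "c = coeff (coeff g 0) 0"
  have g: "g = [:[:c:]:]"
    using 0 by (intro poly_eqI) (auto simp: c_def coeff_pCons split: nat.split)
  then have "c \<noteq> 0" using assms by auto
  then have "g dvd 1" by (auto simp: g is_unit_poly_iff dvd_field_iff)
  then show False using assms by (simp add: irreducible_def)
qed

theorem perfect_iff_unique_branch:
  assumes "irreducible F" "\<not> infinity_point F 0 1"
  shows "perfect F \<longleftrightarrow> (\<exists>B. infinity_branches F = {B} \<and> branch_degree B = total_degree F)"
proof
  assume perfect: "perfect F"
  obtain N p m where sol: "N > 0" "convergent_fps p" "puiseux_solution F m (N, p)" "infinity_point F 1 m"
    using convergent_puiseux_solution[OF assms(2) total_degree_pos[OF assms(1)]] .
  interpret convergent_leaf N p using sol by unfold_locales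
  define B where "B = conjugates (N, p)"
  have B: "B \<in> infinity_branches F" using sol by (auto simp: infinity_branches_def B_def)
  have "\<not> total_degree implicit_poly < total_degree F"
    using perfect B approached_by_implicit_poly irreducible_implicit_poly
    by (auto simp: perfect_def B_def curve_poly_def)
  then have "total_degree F \<le> e" using total_degree_implicit_poly by linarith
  moreover have "e \<le> N" by (simp add: e_def)
  moreover have "N \<le> total_degree F" by (rule ramification_le_total_degree[OF assms(2) sol(3)])
  ultimately have Ne: "N = total_degree F" "e = total_degree F" by simp_all
  have "B' = B" if B': "B' \<in> infinity_branches F" for B'
  proof -
    obtain N' p' m' where B'_eq: "B' = conjugates (N', p')" "puiseux_solution F m' (N', p')"
      using B' by (auto simp: infinity_branches_def)
    have "(N', p') \<in> conjugates (N, p)"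
      by (rule maximal_solution_unique[OF assms(2) sol(3) Ne(1) B'_eq(2)])
    then obtain c where "N' = N" "p' = twist c p" "c ^ N = 1" by (auto simp: conjugates_eq)
    then show ?thesis using B'_eq conjugates_twist sol(1) by (simp add: B_def)
  qed
  then have "infinity_branches F = {B}" using B by blast
  moreover have "branch_degree B = total_degree F"
    using branch_degree_conjugates(2)[OF self_in_conjugates sol(1)] puiseux_degree_eq Ne by (simp add: B_def)
  ultimately show "\<exists>B. infinity_branches F = {B} \<and> branch_degree B = total_degree F" by blast
next
  assume "\<exists>B. infinity_branches F = {B} \<and> branch_degree B = total_degree F"
  then obtain B where B: "infinity_branches F = {B}" "branch_degree B = total_degree F" by blast
  then have "B \<in> infinity_branches F" by simp
  then obtain N p m where sol: "B = conjugates (N, p)" "puiseux_solution F m (N, p)"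
    unfolding infinity_branches_def by auto
  have N: "N > 0" using sol(2) by (simp add: puiseux_solution_iff)
  have deg: "puiseux_degree (N, p) = total_degree F"
    using B(2) sol(1) branch_degree_conjugates(2)[OF self_in_conjugates N] by simp
  \<comment> \<open>The total degree bounds the degree in \<open>y\<close>, which is all that the
    interpolation argument sees.\<close>
  have "\<not> approaches g B" if "curve_poly g" "total_degree g < total_degree F" for g
    unfolding sol(1) using that degree_le_total_degree[of g] deg N
    by (intro not_approaches_low_degree) (auto simp: curve_poly_def)
  then show "perfect F" using assms(2) B(1) by (auto simp: perfect_def)
qed

theorem proposition4p4:
  fixes f :: "real poly poly" and n :: nat
  assumes "irreducible f"
    and "curve_poly (complexify f)"
    and "total_degree (complexify f) = n"
    and "\<not> infinity_point (complexify f) 0 1"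
  shows "perfect (complexify f) \<longleftrightarrow>
    (\<exists>B. infinity_branches (complexify f) = {B} \<and> branch_degree B = n)"
  using perfect_iff_unique_branch[of "complexify f"] assms by (simp add: curve_poly_def)

end
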